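(* Suppose $G$ is a topological group containing a closed, co-precompact, pre-syndetic CAP subgroup $H$. Then $G$ is CAP.
   Context: All topological groups and spaces are Hausdorff. For a topological group $G$, a $G$-flow is a (non-empty) compact Hausdorff space with a continuous left action of $G$; a subflow is a non-empty closed $G$-invariant subset; a flow is minimal if it has no proper subflow. For a $G$-flow $X$, $\mathrm{AP}_G(X)=\{x\in X:\overline{Gx}\text{ is minimal}\}$. $G$ is CAP if $\mathrm{AP}_G(X)$ is closed in $X$ for every $G$-flow $X$. For a closed subgroup $H\subseteq G$, the left coset space $G/H$ is a uniform space whose basic entourages are $\{(gH,kH): gHk^{-1}\cap U\ne\emptyset\}$ for $U$ a symmetric open neighborhood of $1_G$, and $\widehat{G/H}$ is its completion. $H$ is co-precompact in $G$ if $\widehat{G/H}$ is compact; equivalently, for every neighborhood $U$ of $1_G$ there is a finite $F\subseteq G$ with $UFH=G$. A subset $S\subseteq G$ is pre-syndetic if for every neighborhood $U$ of $1_G$ there is a finite $F\subseteq G$ with $FUS=G$. *)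

theory Defs
  imports "HOL-Analysis.Analysis" "HOL-Algebra.Group_Action"
begin

no_notation eq_closure_of (\<open>closure'_of\<index>\<close>)

section \<open>Topological groups and flows\<close>

locale topological_group = group G for G (structure) +
  fixes T :: "'a topology"
  assumes topspace_eq: "topspace T = carrier G"
    and Hausdorff: "Hausdorff_space T"
    and continuous_mult: "continuous_map (prod_topology T T) T (\<lambda>(g, h). g \<otimes> h)"
    and continuous_inv: "continuous_map T T (\<lambda>g. inv g)"

locale flow = group_action G "topspace X" \<phi>
  for G (structure) and T :: "'a topology" and X :: "'x topology" and \<phi> +
  assumes nonempty: "topspace X \<noteq> {}"
    and compact: "compact_space X"
    and Hausdorff: "Hausdorff_space X"
    and continuous_action: "continuous_map (prod_topology T X) X (\<lambda>(g, x). \<phi> g x)"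

definition subflow ::
  "('a, 'b) monoid_scheme \<Rightarrow> 'x topology \<Rightarrow> ('a \<Rightarrow> 'x \<Rightarrow> 'x) \<Rightarrow> 'x set \<Rightarrow> bool" where
  "subflow G X \<phi> Y \<longleftrightarrow>
     Y \<noteq> {} \<and> closedin X Y \<and> (\<forall>g\<in>carrier G. \<forall>y\<in>Y. \<phi> g y \<in> Y)"

text \<open>The subflows of a subflow \<open>Y\<close> of \<open>X\<close>, regarded as a flow in its own right, are exactly
  the subflows of \<open>X\<close> contained in \<open>Y\<close>.\<close>

definition minimal_subflow ::
  "('a, 'b) monoid_scheme \<Rightarrow> 'x topology \<Rightarrow> ('a \<Rightarrow> 'x \<Rightarrow> 'x) \<Rightarrow> 'x set \<Rightarrow> bool" where
  "minimal_subflow G X \<phi> Y \<longleftrightarrow>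
     subflow G X \<phi> Y \<and> (\<forall>Z. subflow G X \<phi> Z \<and> Z \<subseteq> Y \<longrightarrow> Z = Y)"

definition AP ::
  "('a, 'b) monoid_scheme \<Rightarrow> 'x topology \<Rightarrow> ('a \<Rightarrow> 'x \<Rightarrow> 'x) \<Rightarrow> 'x set" where
  "AP G X \<phi> = {x \<in> topspace X. minimal_subflow G X \<phi> (X closure_of (orbit G \<phi> x))}"

text \<open>A formula of HOL cannot quantify over all types, so the property CAP carries the type
  \<open>'x\<close> of the points of the flows as a parameter.  A group is CAP in the unrestricted sense iff
  \<open>CAP TYPE('x) G T\<close> holds for every \<open>'x\<close>.  As an assumption, the single instance
  \<open>'x = 'a \<Rightarrow> real\<close> suffices: see \<open>CAP_every_type\<close> below.\<close>

definition CAP :: "'x itself \<Rightarrow> ('a, 'b) monoid_scheme \<Rightarrow> 'a topology \<Rightarrow> bool" where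
  "CAP _ G T \<longleftrightarrow> (\<forall>(X :: 'x topology) \<phi>. flow G T X \<phi> \<longrightarrow> closedin X (AP G X \<phi>))"


section \<open>Completion of a uniform space\<close>

text \<open>A uniformity is given by its filter of entourages.  The points of the completion are the
  minimal Cauchy filters; minimality refers to inclusion of the families of sets, which is the
  reverse of the order on the type of filters.\<close>

definition Cauchy_for :: "('a \<times> 'a) filter \<Rightarrow> 'a filter \<Rightarrow> bool" where
  "Cauchy_for \<U> F \<longleftrightarrow> F \<noteq> bot \<and> F \<times>\<^sub>F F \<le> \<U>"

definition completion_points :: "('a \<times> 'a) filter \<Rightarrow> 'a filter set" where
  "completion_points \<U> = {F. Cauchy_for \<U> F \<and> (\<forall>F'. Cauchy_for \<U> F' \<and> F \<le> F' \<longrightarrow> F' = F)}"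

text \<open>An entourage \<open>V\<close> extends to the set of pairs \<open>(F, F')\<close> of points of the completion such that
  \<open>A \<times> B \<subseteq> V\<close> for some \<open>A \<in> F\<close> and \<open>B \<in> F'\<close>.\<close>

definition completion :: "('a \<times> 'a) filter \<Rightarrow> 'a filter topology" where
  "completion \<U> = topology (\<lambda>S. S \<subseteq> completion_points \<U> \<and>
     (\<forall>F\<in>S. \<exists>V. eventually V \<U> \<and>
        (\<forall>F'\<in>completion_points \<U>. eventually V (F \<times>\<^sub>F F') \<longrightarrow> F' \<in> S)))"


section \<open>Co-precompact and pre-syndetic\<close>

definition coset_entourage ::
  "('a, 'b) monoid_scheme \<Rightarrow> 'a set \<Rightarrow> 'a set \<Rightarrow> ('a set \<times> 'a set) set" where
  "coset_entourage G H U =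
     {(g <#\<^bsub>G\<^esub> H, k <#\<^bsub>G\<^esub> H) | g k. g \<in> carrier G \<and> k \<in> carrier G \<and>
        (g <#\<^bsub>G\<^esub> H #>\<^bsub>G\<^esub> (inv\<^bsub>G\<^esub> k)) \<inter> U \<noteq> {}}"

definition coset_uniformity ::
  "('a, 'b) monoid_scheme \<Rightarrow> 'a topology \<Rightarrow> 'a set \<Rightarrow> ('a set \<times> 'a set) filter" where
  "coset_uniformity G T H =
     (INF U\<in>{U. openin T U \<and> \<one>\<^bsub>G\<^esub> \<in> U \<and> (\<lambda>u. inv\<^bsub>G\<^esub> u) ` U = U}.
        principal (coset_entourage G H U))"

definition co_precompact :: "('a, 'b) monoid_scheme \<Rightarrow> 'a topology \<Rightarrow> 'a set \<Rightarrow> bool" where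
  "co_precompact G T H \<longleftrightarrow> compact_space (completion (coset_uniformity G T H))"

definition pre_syndetic :: "('a, 'b) monoid_scheme \<Rightarrow> 'a topology \<Rightarrow> 'a set \<Rightarrow> bool" where
  "pre_syndetic G T S \<longleftrightarrow>
     (\<forall>U. openin T U \<and> \<one>\<^bsub>G\<^esub> \<in> U \<longrightarrow>
        (\<exists>F. finite F \<and> F \<subseteq> carrier G \<and> F <#>\<^bsub>G\<^esub> U <#>\<^bsub>G\<^esub> S = carrier G))"


section \<open>Dependence of CAP on the type of the flow\<close>

lemma (in flow) act_closed: "g \<in> carrier G \<Longrightarrow> x \<in> topspace X \<Longrightarrow> \<phi> g x \<in> topspace X"
  using element_image by blast

lemma (in flow) act_one: "x \<in> topspace X \<Longrightarrow> \<phi> \<one> x = x"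
  using id_eq_one by (metis restrict_apply')

lemma (in flow) group_G: "group G"
  using group_hom group_hom.axioms(1) by blast

lemma (in flow) act_mult:
  "x \<in> topspace X \<Longrightarrow> g \<in> carrier G \<Longrightarrow> h \<in> carrier G \<Longrightarrow> \<phi> (g \<otimes> h) x = \<phi> g (\<phi> h x)"
  using composition_rule by blast

lemma (in flow) act_continuous:
  assumes "g \<in> carrier G" "topspace T = carrier G"
  shows "continuous_map X X (\<phi> g)"
proof -
  have "continuous_map X (prod_topology T X) (\<lambda>x. (g, x))"
    using assms by (auto intro: continuous_intros)
  from continuous_map_compose[OF this continuous_action] show ?thesis
    by (simp add: o_def)
qed

lemma (in flow) orbit_subset: "x \<in> topspace X \<Longrightarrow> orbit G \<phi> x \<subseteq> topspace X"
  unfolding orbit_def using act_closed by auto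

lemma (in flow) in_orbit: "x \<in> topspace X \<Longrightarrow> x \<in> orbit G \<phi> x"
proof -
  assume x: "x \<in> topspace X"
  have "\<one> \<in> carrier G" using group_G by (simp add: group.is_monoid)
  with act_one[OF x] show ?thesis unfolding orbit_def by (metis (mono_tags, lifting) mem_Collect_eq)
qed

lemma (in flow) subflow_closure_orbit:
  assumes "x \<in> topspace X" "topspace T = carrier G"
  shows "subflow G X \<phi> (X closure_of (orbit G \<phi> x))"
  unfolding subflow_def
proof (intro conjI ballI)
  show "X closure_of (orbit G \<phi> x) \<noteq> {}"
    using in_orbit[OF assms(1)] closure_of_subset[OF orbit_subset[OF assms(1)]] by blast
  show "closedin X (X closure_of (orbit G \<phi> x))" by simp
  fix g y assume g: "g \<in> carrier G" and y: "y \<in> X closure_of (orbit G \<phi> x)"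
  have "\<phi> g ` orbit G \<phi> x \<subseteq> orbit G \<phi> x"
  proof clarify
    fix y assume "y \<in> orbit G \<phi> x"
    then obtain h where h: "h \<in> carrier G" "y = \<phi> h x" unfolding orbit_def by blast
    then have "\<phi> g y = \<phi> (g \<otimes> h) x" by (simp add: act_mult[OF assms(1) g])
    moreover have "g \<otimes> h \<in> carrier G"
      using g h(1) group_G by (simp add: group.is_monoid monoid.m_closed)
    ultimately show "\<phi> g y \<in> orbit G \<phi> x" unfolding orbit_def by blast
  qed
  then have "X closure_of (\<phi> g ` orbit G \<phi> x) \<subseteq> X closure_of (orbit G \<phi> x)"
    by (rule closure_of_mono)
  moreover have "\<phi> g ` (X closure_of (orbit G \<phi> x)) \<subseteq> X closure_of (\<phi> g ` orbit G \<phi> x)"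
    using act_continuous[OF g assms(2)] by (auto simp: continuous_map_eq_image_closure_subset)
  ultimately show "\<phi> g y \<in> X closure_of (orbit G \<phi> x)" using y by blast
qed

lemma (in flow) closure_orbit_least:
  assumes "subflow G X \<phi> Y" "y \<in> Y"
  shows "X closure_of (orbit G \<phi> y) \<subseteq> Y"
  using assms unfolding subflow_def orbit_def by (intro closure_of_minimal) auto


lemma group_actionI:
  assumes "group G"
    and ext: "\<And>g. g \<in> carrier G \<Longrightarrow> \<phi> g \<in> extensional E"
    and cl: "\<And>g x. g \<in> carrier G \<Longrightarrow> x \<in> E \<Longrightarrow> \<phi> g x \<in> E"
    and one: "\<And>x. x \<in> E \<Longrightarrow> \<phi> \<one>\<^bsub>G\<^esub> x = x"
    and mult: "\<And>g h x. g \<in> carrier G \<Longrightarrow> h \<in> carrier G \<Longrightarrow> x \<in> E \<Longrightarrow>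
      \<phi> (g \<otimes>\<^bsub>G\<^esub> h) x = \<phi> g (\<phi> h x)"
  shows "group_action G E \<phi>"
proof -
  interpret group G by fact
  have bij: "\<phi> g \<in> Bij E" if g: "g \<in> carrier G" for g
  proof -
    have "bij_betw (\<phi> g) E E"
    proof (rule bij_betwI[where g = "\<phi> (inv\<^bsub>G\<^esub> g)"])
      show "\<phi> g \<in> E \<rightarrow> E" "\<phi> (inv\<^bsub>G\<^esub> g) \<in> E \<rightarrow> E" using cl g by auto
      fix x assume x: "x \<in> E"
      show "\<phi> (inv\<^bsub>G\<^esub> g) (\<phi> g x) = x"
        using mult[of "inv\<^bsub>G\<^esub> g" g x] one[OF x] g x by simp
      show "\<phi> g (\<phi> (inv\<^bsub>G\<^esub> g) x) = x"
        using mult[of g "inv\<^bsub>G\<^esub> g" x] one[OF x] g x by simp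
    qed
    then show ?thesis using ext[OF g] by (simp add: Bij_def)
  qed
  have "\<phi> (g \<otimes>\<^bsub>G\<^esub> h) = compose E (\<phi> g) (\<phi> h)" if "g \<in> carrier G" "h \<in> carrier G" for g h
    using that ext[of "g \<otimes>\<^bsub>G\<^esub> h"] mult[OF that]
    by (intro extensionalityI[of _ E]) (auto simp: compose_def)
  then have "\<phi> \<in> hom G (BijGroup E)"
    using bij by (auto simp: hom_def BijGroup_def)
  then show ?thesis
    unfolding group_action_def group_hom_def group_hom_axioms_def
    by (simp add: group_BijGroup is_group)
qed

text \<open>If \<open>x\<close> is a limit of almost periodic points that is not almost periodic, then \<open>x\<close> and a
  subflow \<open>B\<close> of its orbit closure can be separated by a continuous function \<open>f\<close>, and the factor of
  \<open>X\<close> generated by \<open>f\<close>, which lives on a set of functions from the group to the reals, fails the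
  condition as well.\<close>

lemma CAP_every_type:
  fixes G :: "('a, 'b) monoid_scheme"
  assumes "topological_group G T" "CAP TYPE('a \<Rightarrow> real) G T"
  shows "CAP TYPE('x) G T"
  unfolding CAP_def
proof (intro allI impI)
  fix X :: "'x topology" and \<phi>
  assume "flow G T X \<phi>"
  then interpret flow G T X \<phi> .
  interpret tg: topological_group G T by fact
  note tT = tg.topspace_eq
  have APsub: "AP G X \<phi> \<subseteq> topspace X" by (auto simp: AP_def)
  have "x \<in> AP G X \<phi>" if x: "x \<in> X closure_of AP G X \<phi>" for x
  proof (rule ccontr)
    assume nx: "x \<notin> AP G X \<phi>"
    have xX: "x \<in> topspace X" using x by (meson in_closure_of)
    obtain B where B: "subflow G X \<phi> B" "B \<subseteq> X closure_of (orbit G \<phi> x)"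
      "B \<noteq> X closure_of (orbit G \<phi> x)"
      using nx xX subflow_closure_orbit[OF xX tT] unfolding AP_def minimal_subflow_def by blast
    have xB: "x \<notin> B" using closure_orbit_least[OF B(1)] B(2,3) by blast
    have nrm: "normal_space X"
      using compact Hausdorff by (simp add: compact_Hausdorff_or_regular_imp_normal_space)
    have clx: "closedin X {x}"
      using Hausdorff xX by (simp add: closedin_Hausdorff_singleton)
    have "disjnt B {x}" using xB by (simp add: disjnt_def)
    then obtain f where f0: "continuous_map X (top_of_set {0..1::real}) f" "f ` B \<subseteq> {0}" "f ` {x} \<subseteq> {1}"
      using Urysohn_lemma[OF nrm _ clx, of B 0 1] B(1) unfolding subflow_def
      by (metis zero_le_one)
    have f: "continuous_map X euclideanreal f"
      using f0(1) by (simp add: continuous_map_in_subtopology)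
    define \<pi> where "\<pi> = (\<lambda>z. \<lambda>k\<in>carrier G. f (\<phi> k z))"
    define P where "P = product_topology (\<lambda>_::'a. euclideanreal) (carrier G)"
    define Y where "Y = subtopology P (\<pi> ` topspace X)"
    define \<psi> where "\<psi> = (\<lambda>h. \<lambda>y\<in>\<pi> ` topspace X. \<lambda>k\<in>carrier G. y (k \<otimes>\<^bsub>G\<^esub> h))"
    have \<pi>P: "\<pi> z \<in> topspace P" for z by (auto simp: \<pi>_def P_def)
    then have tY: "topspace Y = \<pi> ` topspace X" by (auto simp: Y_def)
    have \<psi>\<pi>: "\<psi> h (\<pi> z) = \<pi> (\<phi> h z)" if "h \<in> carrier G" "z \<in> topspace X" for h z
      using that by (auto simp: \<psi>_def \<pi>_def act_mult fun_eq_iff)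
    have c\<pi>P: "continuous_map X P \<pi>"
      unfolding P_def \<pi>_def continuous_map_componentwise
    proof (intro conjI ballI)
      show "(\<lambda>z. \<lambda>k\<in>carrier G. f (\<phi> k z)) ` topspace X \<subseteq> extensional (carrier G)" by auto
      fix k assume k: "k \<in> carrier G"
      then show "continuous_map X euclideanreal (\<lambda>z. (\<lambda>k\<in>carrier G. f (\<phi> k z)) k)"
        using continuous_map_compose[OF act_continuous[OF k tT] f] by (simp add: o_def)
    qed
    then have c\<pi>: "continuous_map X Y \<pi>"
      by (auto simp: Y_def continuous_map_in_subtopology)
    have HP: "Hausdorff_space P" unfolding P_def by (simp add: Hausdorff_space_product_topology)
    then have HY: "Hausdorff_space Y" unfolding Y_def by (simp add: Hausdorff_space_subtopology)
    have cY: "compact_space Y"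
      using image_compactin[OF _ c\<pi>, of "topspace X"] compact tY by (simp add: compact_space_def)
    have cl\<pi>: "closed_map X Y \<pi>"
      using continuous_imp_closed_map[OF c\<pi> compact HY] .
    have ga: "group_action G (topspace Y) \<psi>"
      unfolding tY
    proof (rule group_actionI)
      show "group G" by (rule group_G)
      show "\<psi> g \<in> extensional (\<pi> ` topspace X)" for g by (simp add: \<psi>_def)
      show "\<psi> g y \<in> \<pi> ` topspace X" if "g \<in> carrier G" "y \<in> \<pi> ` topspace X" for g y
        using that \<psi>\<pi> act_closed by auto
      show "\<psi> \<one>\<^bsub>G\<^esub> y = y" if "y \<in> \<pi> ` topspace X" for y
        using that \<psi>\<pi> act_one by auto
      show "\<psi> (g \<otimes>\<^bsub>G\<^esub> h) y = \<psi> g (\<psi> h y)"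
        if "g \<in> carrier G" "h \<in> carrier G" "y \<in> \<pi> ` topspace X" for g h y
        using that \<psi>\<pi> act_mult act_closed by auto
    qed
    have q: "quotient_map (prod_topology T X) (prod_topology T Y) (\<lambda>(g, z). (g, \<pi> z))"
    proof (rule continuous_closed_imp_quotient_map)
      have "proper_map X Y \<pi>"
        using c\<pi> compact HY by (simp add: continuous_imp_proper_map Hausdorff_imp_kc_space)
      moreover have "proper_map T T (\<lambda>g. g)"
        using proper_map_id[of T] by (simp add: id_def)
      ultimately have "proper_map (prod_topology T X) (prod_topology T Y) (\<lambda>(g, z). (g, \<pi> z))"
        by (simp add: proper_map_prod)
      then show "closed_map (prod_topology T X) (prod_topology T Y) (\<lambda>(g, z). (g, \<pi> z))"
        by (rule proper_imp_closed_map)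
      show "continuous_map (prod_topology T X) (prod_topology T Y) (\<lambda>(g, z). (g, \<pi> z))"
        using c\<pi> by (simp add: continuous_map_prod_top)
      show "(\<lambda>(g, z). (g, \<pi> z)) ` topspace (prod_topology T X) = topspace (prod_topology T Y)"
        by (auto simp: tY)
    qed
    have "continuous_map (prod_topology T X) Y (\<pi> \<circ> (\<lambda>(g, z). \<phi> g z))"
      by (rule continuous_map_compose[OF continuous_action c\<pi>])
    then have "continuous_map (prod_topology T X) Y ((\<lambda>(g, y). \<psi> g y) \<circ> (\<lambda>(g, z). (g, \<pi> z)))"
      by (rule continuous_map_eq) (auto simp: tT \<psi>\<pi>)
    then have c\<psi>: "continuous_map (prod_topology T Y) Y (\<lambda>(g, y). \<psi> g y)"
      by (rule continuous_compose_quotient_map[OF q])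
    have fY: "flow G T Y \<psi>"
      unfolding flow_def flow_axioms_def using ga HY cY c\<psi> nonempty tY by auto
    then have clAP: "closedin Y (AP G Y \<psi>)" using assms(2) unfolding CAP_def by blast
    have img: "Y closure_of (orbit G \<psi> (\<pi> z)) = \<pi> ` (X closure_of (orbit G \<phi> z))"
      if z: "z \<in> topspace X" for z
    proof -
      have "orbit G \<psi> (\<pi> z) = \<pi> ` orbit G \<phi> z"
        unfolding orbit_def using \<psi>\<pi>[OF _ z] by (auto simp: image_iff) metis
      moreover have "Y closure_of (\<pi> ` orbit G \<phi> z) \<subseteq> \<pi> ` (X closure_of (orbit G \<phi> z))"
        using cl\<pi> orbit_subset[OF z] by (simp add: closed_map_closure_of_image)
      moreover have "\<pi> ` (X closure_of (orbit G \<phi> z)) \<subseteq> Y closure_of (\<pi> ` orbit G \<phi> z)"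
        using c\<pi> by (auto simp: continuous_map_eq_image_closure_subset)
      ultimately show ?thesis by simp
    qed
    have "\<pi> ` AP G X \<phi> \<subseteq> AP G Y \<psi>"
    proof clarify
      fix a assume a: "a \<in> AP G X \<phi>"
      let ?M = "X closure_of (orbit G \<phi> a)"
      have aX: "a \<in> topspace X" and min: "minimal_subflow G X \<phi> ?M" using a by (auto simp: AP_def)
      interpret fY: flow G T Y \<psi> by fact
      have \<pi>a: "\<pi> a \<in> topspace Y" using aX tY by simp
      have "C = \<pi> ` ?M" if C: "subflow G Y \<psi> C" "C \<subseteq> \<pi> ` ?M" for C
      proof -
        let ?D = "{z \<in> topspace X. \<pi> z \<in> C} \<inter> ?M"
        have M: "subflow G X \<phi> ?M" using min by (simp add: minimal_subflow_def)
        have "subflow G X \<phi> ?D"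
          unfolding subflow_def
        proof (intro conjI ballI)
          show "?D \<noteq> {}" using C closure_of_subset_topspace[of X] unfolding subflow_def by blast
          show "closedin X ?D"
            using C(1) unfolding subflow_def
            by (intro closedin_Int closedin_continuous_map_preimage[OF c\<pi>]) auto
          fix g z assume gz: "g \<in> carrier G" "z \<in> ?D"
          then have "\<pi> (\<phi> g z) = \<psi> g (\<pi> z)" using \<psi>\<pi> by simp
          then show "\<phi> g z \<in> ?D"
            using gz C(1) M act_closed unfolding subflow_def by auto
        qed
        then have "?D = ?M" using min unfolding minimal_subflow_def by blast
        then show ?thesis using C(2) by blast
      qed
      then have "minimal_subflow G Y \<psi> (\<pi> ` ?M)"
        using fY.subflow_closure_orbit[OF \<pi>a tT] img[OF aX] unfolding minimal_subflow_def by auto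
      then show "\<pi> a \<in> AP G Y \<psi>" using \<pi>a img[OF aX] by (simp add: AP_def)
    qed
    then have "Y closure_of (\<pi> ` AP G X \<phi>) \<subseteq> AP G Y \<psi>" using clAP by (rule closure_of_minimal)
    moreover have "\<pi> x \<in> Y closure_of (\<pi> ` AP G X \<phi>)"
      using x c\<pi> by (auto simp: continuous_map_eq_image_closure_subset)
    ultimately have "minimal_subflow G Y \<psi> (\<pi> ` (X closure_of (orbit G \<phi> x)))"
      using img[OF xX] by (auto simp: AP_def)
    moreover have "subflow G Y \<psi> (\<pi> ` B)"
      unfolding subflow_def
    proof (intro conjI ballI)
      show "\<pi> ` B \<noteq> {}" using B(1) by (simp add: subflow_def)
      show "closedin Y (\<pi> ` B)" using B(1) cl\<pi> by (simp add: subflow_def closed_map_def)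
      fix g y assume g: "g \<in> carrier G" and "y \<in> \<pi> ` B"
      then obtain b where b: "b \<in> B" "y = \<pi> b" by blast
      have "b \<in> topspace X" using b B(1) by (meson subflow_def closedin_subset subsetD)
      then have "\<psi> g y = \<pi> (\<phi> g b)" using \<psi>\<pi> g b by simp
      then show "\<psi> g y \<in> \<pi> ` B" using B(1) g b unfolding subflow_def by auto
    qed
    ultimately have "\<pi> ` B = \<pi> ` (X closure_of (orbit G \<phi> x))"
      using B(2) unfolding minimal_subflow_def by blast
    moreover have "x \<in> X closure_of (orbit G \<phi> x)"
      using in_orbit[OF xX] closure_of_subset[OF orbit_subset[OF xX]] by blast
    ultimately obtain b where b: "b \<in> B" "\<pi> b = \<pi> x" by (metis image_iff)
    have "b \<in> topspace X" using b B(1) by (meson subflow_def closedin_subset subsetD)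
    moreover have "\<pi> b \<one>\<^bsub>G\<^esub> = \<pi> x \<one>\<^bsub>G\<^esub>" using b by simp
    ultimately have "f b = f x" using xX act_one by (simp add: \<pi>_def)
    then show False using b f0 by auto
  qed
  then show "closedin X (AP G X \<phi>)"
    using APsub closure_of_subset_eq[of "AP G X \<phi>" X] by blast
qed


section \<open>Co-precompactness in terms of finite covers\<close>

lemma openin_completion:
  "openin (completion \<U>) S \<longleftrightarrow> S \<subseteq> completion_points \<U> \<and>
     (\<forall>F\<in>S. \<exists>V. eventually V \<U> \<and>
        (\<forall>F'\<in>completion_points \<U>. eventually V (F \<times>\<^sub>F F') \<longrightarrow> F' \<in> S))"
proof -
  let ?P = "\<lambda>S F V. eventually V \<U> \<and>
        (\<forall>F'\<in>completion_points \<U>. eventually V (F \<times>\<^sub>F F') \<longrightarrow> F' \<in> S)"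
  have "istopology (\<lambda>S. S \<subseteq> completion_points \<U> \<and> (\<forall>F\<in>S. \<exists>V. ?P S F V))"
    unfolding istopology_def
  proof (intro conjI allI impI ballI)
    fix S S' assume S: "S \<subseteq> completion_points \<U> \<and> (\<forall>F\<in>S. \<exists>V. ?P S F V)"
      and S': "S' \<subseteq> completion_points \<U> \<and> (\<forall>F\<in>S'. \<exists>V. ?P S' F V)"
    show "S \<inter> S' \<subseteq> completion_points \<U>" using S by blast
    fix F assume "F \<in> S \<inter> S'"
    then obtain V V' where V: "?P S F V" "?P S' F V'" using S S' by blast
    then have "?P (S \<inter> S') F (\<lambda>p. V p \<and> V' p)" by (simp add: eventually_conj_iff)
    then show "\<exists>V. ?P (S \<inter> S') F V" by blast
  next
    fix \<K> assume K: "\<forall>S\<in>\<K>. S \<subseteq> completion_points \<U> \<and> (\<forall>F\<in>S. \<exists>V. ?P S F V)"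
    then show "\<Union>\<K> \<subseteq> completion_points \<U>" by blast
    fix F assume "F \<in> \<Union>\<K>"
    then obtain S where S: "S \<in> \<K>" "F \<in> S" by blast
    then obtain V where "?P S F V" using K by meson
    then have "?P (\<Union>\<K>) F V" using S by blast
    then show "\<exists>V. ?P (\<Union>\<K>) F V" by blast
  qed
  then show ?thesis unfolding completion_def by (simp add: topology_inverse')
qed

lemma topspace_completion [simp]: "topspace (completion \<U>) = completion_points \<U>"
proof
  show "topspace (completion \<U>) \<subseteq> completion_points \<U>"
    using openin_topspace[of "completion \<U>"] unfolding openin_completion by blast
  have "openin (completion \<U>) (completion_points \<U>)"
    unfolding openin_completion by (auto intro!: exI[of _ "\<lambda>_. True"])
  then show "completion_points \<U> \<subseteq> topspace (completion \<U>)" by (rule openin_subset)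
qed

context topological_group
begin

definition sym_nhds :: "'a set set" where
  "sym_nhds = {U. openin T U \<and> \<one> \<in> U \<and> (\<lambda>u. inv u) ` U = U}"

lemma sym_nhdsD:
  assumes "U \<in> sym_nhds"
  shows "U \<subseteq> carrier G" "openin T U" "\<one> \<in> U" "u \<in> U \<Longrightarrow> inv u \<in> U"
  using assms openin_subset[of T U] topspace_eq unfolding sym_nhds_def by auto

lemma sym_nhds_shrink:
  assumes "openin T U" "\<one> \<in> U"
  obtains V where "V \<in> sym_nhds" "V \<subseteq> U" "\<And>u v. u \<in> V \<Longrightarrow> v \<in> V \<Longrightarrow> u \<otimes> v \<in> U"
proof -
  let ?m = "\<lambda>(g, h). g \<otimes> h"
  let ?N = "{p \<in> topspace (prod_topology T T). ?m p \<in> U}"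
  have "openin (prod_topology T T) ?N"
    using continuous_mult assms(1) by (rule openin_continuous_map_preimage)
  moreover have "(\<one>, \<one>) \<in> ?N" using assms(2) topspace_eq by simp
  ultimately obtain A B where AB: "openin T A" "openin T B" "\<one> \<in> A" "\<one> \<in> B" "A \<times> B \<subseteq> ?N"
    unfolding openin_prod_topology_alt by meson
  define C where "C = A \<inter> B \<inter> U"
  have C: "openin T C" "\<one> \<in> C" using AB assms by (auto simp: C_def)
  define V where "V = C \<inter> {g \<in> topspace T. inv g \<in> C}"
  have sub: "V \<subseteq> carrier G" using openin_subset[OF C(1)] topspace_eq by (auto simp: V_def)
  have "openin T V" unfolding V_def
    using C(1) openin_continuous_map_preimage[OF continuous_inv C(1)] by blast
  moreover have "\<one> \<in> V" using C topspace_eq by (simp add: V_def)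
  moreover have inv: "inv u \<in> V" if "u \<in> V" for u
    using that sub topspace_eq by (auto simp: V_def)
  moreover have "(\<lambda>u. inv u) ` V = V"
  proof
    show "(\<lambda>u. inv u) ` V \<subseteq> V" using inv by blast
    show "V \<subseteq> (\<lambda>u. inv u) ` V"
    proof
      fix u assume u: "u \<in> V"
      then have "u = inv (inv u)" using sub by auto
      then show "u \<in> (\<lambda>u. inv u) ` V" using inv[OF u] by blast
    qed
  qed
  ultimately have "V \<in> sym_nhds" by (simp add: sym_nhds_def)
  moreover have "V \<subseteq> U" by (auto simp: V_def C_def)
  moreover have "u \<otimes> v \<in> U" if "u \<in> V" "v \<in> V" for u v
  proof -
    have "(u, v) \<in> A \<times> B" using that by (auto simp: V_def C_def)
    then show ?thesis using AB(5) by auto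
  qed
  ultimately show ?thesis using that by blast
qed

lemma sym_nhds_Int:
  assumes "U \<in> sym_nhds" "V \<in> sym_nhds"
  obtains W where "W \<in> sym_nhds" "W \<subseteq> U \<inter> V"
proof -
  have UV: "openin T (U \<inter> V)" "\<one> \<in> U \<inter> V"
    using assms[THEN sym_nhdsD(2)] assms[THEN sym_nhdsD(3)] by (auto intro: openin_Int)
  show ?thesis by (rule sym_nhds_shrink[OF UV]) (rule that)
qed

lemma eventually_coset_uniformity:
  "eventually P (coset_uniformity G T H) \<longleftrightarrow>
     (\<exists>U\<in>sym_nhds. \<forall>p\<in>coset_entourage G H U. P p)"
proof -
  have "sym_nhds \<noteq> {}"
    using sym_nhds_shrink[of "carrier G"] topspace_eq by (metis empty_iff one_closed openin_topspace)
  moreover have "\<exists>W\<in>sym_nhds. principal (coset_entourage G H W) \<le>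
      inf (principal (coset_entourage G H U)) (principal (coset_entourage G H V))"
    if UV: "U \<in> sym_nhds" "V \<in> sym_nhds" for U V
  proof -
    obtain W where W: "W \<in> sym_nhds" "W \<subseteq> U \<inter> V"
      using sym_nhds_Int[OF UV] .
    then have "coset_entourage G H W \<subseteq> coset_entourage G H U \<inter> coset_entourage G H V"
      unfolding coset_entourage_def by blast
    then show ?thesis using W(1) by (intro bexI[of _ W]) auto
  qed
  ultimately have "eventually P (INF U\<in>sym_nhds. principal (coset_entourage G H U)) \<longleftrightarrow>
      (\<exists>U\<in>sym_nhds. eventually P (principal (coset_entourage G H U)))"
    by (intro eventually_INF_base) auto
  then show ?thesis unfolding coset_uniformity_def sym_nhds_def eventually_principal .
qed

lemma coset_entourage_iff:
  assumes H: "subgroup H G" and U: "U \<subseteq> carrier G"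
  shows "(A, B) \<in> coset_entourage G H U \<longleftrightarrow>
    (\<exists>k\<in>carrier G. B = k <#\<^bsub>G\<^esub> H \<and> (\<exists>u\<in>U. A = (u \<otimes> k) <#\<^bsub>G\<^esub> H))"
proof
  assume "(A, B) \<in> coset_entourage G H U"
  then obtain g k where gk: "g \<in> carrier G" "k \<in> carrier G" "A = g <#\<^bsub>G\<^esub> H" "B = k <#\<^bsub>G\<^esub> H"
    "(g <#\<^bsub>G\<^esub> H #> inv k) \<inter> U \<noteq> {}" unfolding coset_entourage_def by blast
  then obtain h where h: "h \<in> H" "g \<otimes> h \<otimes> inv k \<in> U"
    unfolding l_coset_def r_coset_def by blast
  have hG: "h \<in> carrier G" using h(1) H by (meson subgroup.mem_carrier)
  have "(g \<otimes> h \<otimes> inv k) \<otimes> k = g \<otimes> h" using gk hG by (simp add: m_assoc)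
  moreover have "(g \<otimes> h) <#\<^bsub>G\<^esub> H = g <#\<^bsub>G\<^esub> H"
    using lcos_m_assoc[OF subgroup.subset[OF H] gk(1) hG] coset_join3[OF hG H h(1)] by simp
  ultimately show "\<exists>k\<in>carrier G. B = k <#\<^bsub>G\<^esub> H \<and> (\<exists>u\<in>U. A = (u \<otimes> k) <#\<^bsub>G\<^esub> H)"
    using gk h(2) by metis
next
  assume "\<exists>k\<in>carrier G. B = k <#\<^bsub>G\<^esub> H \<and> (\<exists>u\<in>U. A = (u \<otimes> k) <#\<^bsub>G\<^esub> H)"
  then obtain k u where ku: "k \<in> carrier G" "B = k <#\<^bsub>G\<^esub> H" "u \<in> U" "A = (u \<otimes> k) <#\<^bsub>G\<^esub> H" by blast
  have uG: "u \<in> carrier G" using ku U by blast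
  have "(u \<otimes> k) \<otimes> \<one> \<otimes> inv k = u" using ku(1) uG by (simp add: m_assoc)
  moreover have "\<one> \<in> H" using H by (simp add: subgroup.one_closed)
  ultimately have "u \<in> (u \<otimes> k) <#\<^bsub>G\<^esub> H #> inv k"
    unfolding l_coset_def r_coset_def by force
  moreover have "u \<otimes> k \<in> carrier G" using uG ku(1) by simp
  ultimately show "(A, B) \<in> coset_entourage G H U"
    unfolding coset_entourage_def using ku by blast
qed

lemma coset_entourage_sym:
  assumes H: "subgroup H G" and U: "U \<in> sym_nhds" and AB: "(A, B) \<in> coset_entourage G H U"
  shows "(B, A) \<in> coset_entourage G H U"
proof -
  note UG = sym_nhdsD(1)[OF U]
  obtain k u where ku: "k \<in> carrier G" "B = k <#\<^bsub>G\<^esub> H" "u \<in> U" "A = (u \<otimes> k) <#\<^bsub>G\<^esub> H"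
    using AB coset_entourage_iff[OF H UG] by blast
  have uG: "u \<in> carrier G" using ku UG by blast
  have "inv u \<otimes> (u \<otimes> k) = k" using uG ku(1) by (simp add: m_assoc[symmetric])
  then show ?thesis
    unfolding coset_entourage_iff[OF H UG] using ku uG sym_nhdsD(4)[OF U ku(3)]
    by (intro bexI[where x = "u \<otimes> k" and A = "carrier G"] conjI bexI[where x = "inv u" and A = U]) auto
qed

lemma coset_entourage_comp:
  assumes H: "subgroup H G" and U: "U \<subseteq> carrier G" and V: "V \<in> sym_nhds"
    and VV: "\<And>u v. u \<in> V \<Longrightarrow> v \<in> V \<Longrightarrow> u \<otimes> v \<in> U"
    and AB: "(A, B) \<in> coset_entourage G H V" and BC: "(B, C) \<in> coset_entourage G H V"
  shows "(A, C) \<in> coset_entourage G H U"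
proof -
  note VG = sym_nhdsD(1)[OF V]
  note sub = subgroup.subset[OF H]
  obtain k u where ku: "k \<in> carrier G" "B = k <#\<^bsub>G\<^esub> H" "u \<in> V" "A = (u \<otimes> k) <#\<^bsub>G\<^esub> H"
    using AB coset_entourage_iff[OF H VG] by blast
  obtain l v where lv: "l \<in> carrier G" "C = l <#\<^bsub>G\<^esub> H" "v \<in> V" "B = (v \<otimes> l) <#\<^bsub>G\<^esub> H"
    using BC coset_entourage_iff[OF H VG] by blast
  have uv: "u \<in> carrier G" "v \<in> carrier G" using ku lv VG by auto
  have "A = u <#\<^bsub>G\<^esub> B" using ku uv by (simp add: lcos_m_assoc[OF sub])
  also have "\<dots> = (u \<otimes> v \<otimes> l) <#\<^bsub>G\<^esub> H" using lv uv by (simp add: lcos_m_assoc[OF sub] m_assoc)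
  finally show ?thesis
    unfolding coset_entourage_iff[OF H U] using lv VV[OF ku(3) lv(3)] by blast
qed

lemma coset_entourage_refl:
  assumes "subgroup H G" "U \<in> sym_nhds" "k \<in> carrier G"
  shows "(k <#\<^bsub>G\<^esub> H, k <#\<^bsub>G\<^esub> H) \<in> coset_entourage G H U"
  unfolding coset_entourage_iff[OF assms(1) sym_nhdsD(1)[OF assms(2)]]
  using assms(3) sym_nhdsD(3)[OF assms(2)]
  by (intro bexI[where x = k and A = "carrier G"] conjI bexI[where x = "\<one>" and A = U]) auto

lemma Cauchy_for_coset:
  "Cauchy_for (coset_uniformity G T H) F \<longleftrightarrow> F \<noteq> bot \<and>
    (\<forall>U\<in>sym_nhds. \<exists>P. eventually P F \<and> (\<forall>A B. P A \<longrightarrow> P B \<longrightarrow> (A, B) \<in> coset_entourage G H U))"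
  (is "?l \<longleftrightarrow> ?r")
proof -
  have "F \<times>\<^sub>F F \<le> coset_uniformity G T H \<longleftrightarrow>
      (\<forall>U\<in>sym_nhds. eventually (\<lambda>p. p \<in> coset_entourage G H U) (F \<times>\<^sub>F F))" (is "?a \<longleftrightarrow> ?b")
  proof
    assume ?a
    moreover have "eventually (\<lambda>p. p \<in> coset_entourage G H U) (coset_uniformity G T H)"
      if "U \<in> sym_nhds" for U
      unfolding eventually_coset_uniformity using that by (intro bexI[of _ U]) auto
    ultimately show ?b using filter_leD by blast
  next
    assume b: ?b
    show ?a
    proof (rule filter_leI)
      fix P assume "eventually P (coset_uniformity G T H)"
      then obtain U where U: "U \<in> sym_nhds" "\<And>p. p \<in> coset_entourage G H U \<Longrightarrow> P p"
        unfolding eventually_coset_uniformity by blast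
      from b U(1) have "eventually (\<lambda>p. p \<in> coset_entourage G H U) (F \<times>\<^sub>F F)" by blast
      then show "eventually P (F \<times>\<^sub>F F)" by (rule eventually_mono) (rule U(2))
    qed
  qed
  then show ?thesis
    unfolding Cauchy_for_def by (simp add: eventually_prod_same)
qed

lemma coset_nhds_point:
  assumes H: "subgroup H G" and g: "g \<in> carrier G"
  obtains N where "N \<in> completion_points (coset_uniformity G T H)"
    "\<And>P. eventually P N \<Longrightarrow> P (g <#\<^bsub>G\<^esub> H)"
proof -
  define E where "E = coset_entourage G H"
  define Q where "Q = (\<lambda>U. {B. (B, g <#\<^bsub>G\<^esub> H) \<in> E U})"
  define N where "N = (INF U\<in>sym_nhds. principal (Q U))"
  have ne: "sym_nhds \<noteq> {}"
    using sym_nhds_shrink[of "carrier G"] topspace_eq by (metis empty_iff one_closed openin_topspace)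
  have "\<exists>W\<in>sym_nhds. principal (Q W) \<le> inf (principal (Q U)) (principal (Q V))"
    if UV: "U \<in> sym_nhds" "V \<in> sym_nhds" for U V
  proof -
    obtain W where W: "W \<in> sym_nhds" "W \<subseteq> U \<inter> V"
      using sym_nhds_Int[OF UV] .
    then have "Q W \<subseteq> Q U \<inter> Q V"
      unfolding Q_def E_def coset_entourage_def by blast
    then show ?thesis using W(1) by (intro bexI[of _ W]) auto
  qed
  then have evN: "eventually P N \<longleftrightarrow> (\<exists>U\<in>sym_nhds. \<forall>B\<in>Q U. P B)" for P
    unfolding N_def using eventually_INF_base[OF ne, of "\<lambda>U. principal (Q U)" P]
    by (simp add: eventually_principal)
  have gQ: "g <#\<^bsub>G\<^esub> H \<in> Q U" if "U \<in> sym_nhds" for U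
    using coset_entourage_refl[OF H that g] by (simp add: Q_def E_def)
  have at: "P (g <#\<^bsub>G\<^esub> H)" if "eventually P N" for P using that gQ evN by blast
  have "N \<noteq> bot" using at[of "\<lambda>_. False"] by auto
  have shrink: "\<exists>V\<in>sym_nhds. \<forall>A B C. (A, B) \<in> E V \<longrightarrow> (B, C) \<in> E V \<longrightarrow> (A, C) \<in> E U"
    if U: "U \<in> sym_nhds" for U
  proof -
    obtain V where V: "V \<in> sym_nhds" "\<And>u v. u \<in> V \<Longrightarrow> v \<in> V \<Longrightarrow> u \<otimes> v \<in> U"
      by (rule sym_nhds_shrink[OF sym_nhdsD(2,3)[OF U]]) (rule that)
    have UG: "U \<subseteq> carrier G" using U by (rule sym_nhdsD(1))
    have "\<forall>A B C. (A, B) \<in> E V \<longrightarrow> (B, C) \<in> E V \<longrightarrow> (A, C) \<in> E U"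
    proof (intro allI impI)
      fix A B C assume AB: "(A, B) \<in> E V" "(B, C) \<in> E V"
      show "(A, C) \<in> E U"
        unfolding E_def
        by (rule coset_entourage_comp[OF H UG V(1) _ AB[unfolded E_def]]) (rule V(2))
    qed
    then show ?thesis using V(1) by (rule bexI)
  qed
  have cN: "Cauchy_for (coset_uniformity G T H) N"
    unfolding Cauchy_for_coset
  proof (intro conjI ballI)
    show "N \<noteq> bot" by fact
    fix U assume U: "U \<in> sym_nhds"
    obtain V where V: "V \<in> sym_nhds" "\<And>A B C. (A, B) \<in> E V \<Longrightarrow> (B, C) \<in> E V \<Longrightarrow> (A, C) \<in> E U"
      using shrink[OF U] by blast
    have "eventually (\<lambda>B. B \<in> Q V) N" using evN V(1) by blast
    moreover have "(A, B) \<in> E U" if "A \<in> Q V" "B \<in> Q V" for A B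
      using that V coset_entourage_sym[OF H V(1)] unfolding Q_def E_def by blast
    ultimately show "\<exists>P. eventually P N \<and> (\<forall>A B. P A \<longrightarrow> P B \<longrightarrow> (A, B) \<in> coset_entourage G H U)"
      unfolding E_def by blast
  qed
  have "F' = N" if F': "Cauchy_for (coset_uniformity G T H) F'" and le: "N \<le> F'" for F'
  proof (rule antisym[OF _ le])
    show "F' \<le> N"
    proof (rule filter_leI)
      fix P assume "eventually P N"
      then obtain U where U: "U \<in> sym_nhds" "\<forall>B\<in>Q U. P B" using evN by blast
      obtain R where R: "eventually R F'" "\<And>A B. R A \<Longrightarrow> R B \<Longrightarrow> (A, B) \<in> E U"
        using F' U(1) unfolding Cauchy_for_coset E_def by blast
      have "R (g <#\<^bsub>G\<^esub> H)" using at filter_leD[OF le R(1)] by blast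
      then have "\<And>A. R A \<Longrightarrow> P A" using R(2) U(2) unfolding Q_def by blast
      then show "eventually P F'" using R(1) by (rule eventually_mono[rotated])
    qed
  qed
  then have "N \<in> completion_points (coset_uniformity G T H)"
    using cN unfolding completion_points_def by blast
  then show ?thesis using that at by blast
qed

lemma co_precompact_imp_finite_cover:
  assumes H: "subgroup H G" and cpt: "co_precompact G T H"
    and U0: "openin T U\<^sub>0" "\<one> \<in> U\<^sub>0"
  shows "\<exists>F. finite F \<and> F \<subseteq> carrier G \<and> U\<^sub>0 <#> F <#> H = carrier G"
proof -
  define E where "E = coset_entourage G H"
  define K where "K = completion_points (coset_uniformity G T H)"
  have shrink: "\<exists>V\<in>sym_nhds. \<forall>A B C. (A, B) \<in> E V \<longrightarrow> (B, C) \<in> E V \<longrightarrow> (A, C) \<in> E U"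
    if U: "openin T U" "\<one> \<in> U" for U
  proof -
    obtain V where V: "V \<in> sym_nhds" "\<And>u v. u \<in> V \<Longrightarrow> v \<in> V \<Longrightarrow> u \<otimes> v \<in> U"
      by (rule sym_nhds_shrink[OF U]) (rule that)
    have UG: "U \<subseteq> carrier G" using openin_subset[OF U(1)] topspace_eq by simp
    have "\<forall>A B C. (A, B) \<in> E V \<longrightarrow> (B, C) \<in> E V \<longrightarrow> (A, C) \<in> E U"
    proof (intro allI impI)
      fix A B C assume AB: "(A, B) \<in> E V" "(B, C) \<in> E V"
      show "(A, C) \<in> E U"
        unfolding E_def
        by (rule coset_entourage_comp[OF H UG V(1) _ AB[unfolded E_def]]) (rule V(2))
    qed
    then show ?thesis using V(1) by (rule bexI)
  qed
  obtain W where W: "W \<in> sym_nhds"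
    "\<And>A B C. (A, B) \<in> E W \<Longrightarrow> (B, C) \<in> E W \<Longrightarrow> (A, C) \<in> E U\<^sub>0"
    using shrink[OF U0] by blast
  define near where "near = (\<lambda>V F F'. eventually (\<lambda>p. p \<in> E V) (F \<times>\<^sub>F F'))"
  define Op where "Op = (\<lambda>F. {F' \<in> K. \<exists>V\<in>sym_nhds. \<forall>F''\<in>K. near V F' F'' \<longrightarrow> near W F F''})"
  have KC: "Cauchy_for (coset_uniformity G T H) F" if "F \<in> K" for F
    using that by (simp add: K_def completion_points_def)
  have near_refl: "near V F F" if "V \<in> sym_nhds" "F \<in> K" for V F
    using KC[OF that(2)] that(1) unfolding Cauchy_for_coset near_def E_def eventually_prod_same
    by blast
  have ev: "eventually (\<lambda>p. p \<in> E V) (coset_uniformity G T H)" if "V \<in> sym_nhds" for V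
    using that unfolding eventually_coset_uniformity E_def by blast
  have OpOpen: "openin (completion (coset_uniformity G T H)) (Op F)" for F
    unfolding openin_completion K_def[symmetric]
  proof (intro conjI ballI)
    show "Op F \<subseteq> K" by (auto simp: Op_def)
    fix F' assume "F' \<in> Op F"
    then obtain V where V: "V \<in> sym_nhds" "\<And>F''. F'' \<in> K \<Longrightarrow> near V F' F'' \<Longrightarrow> near W F F''"
      and F': "F' \<in> K" unfolding Op_def by blast
    obtain V' where V': "V' \<in> sym_nhds" "\<And>A B C. (A, B) \<in> E V' \<Longrightarrow> (B, C) \<in> E V' \<Longrightarrow> (A, C) \<in> E V"
      using shrink[OF sym_nhdsD(2,3)[OF V(1)]] by blast
    have "F1 \<in> Op F" if F1: "F1 \<in> K" and n1: "near V' F' F1" for F1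
    proof -
      have "near V F' F2" if F2: "F2 \<in> K" and n2: "near V' F1 F2" for F2
      proof -
        obtain P1 P2 where P: "eventually P1 F'" "eventually P2 F1"
          "\<And>x y. P1 x \<Longrightarrow> P2 y \<Longrightarrow> (x, y) \<in> E V'"
          using n1 unfolding near_def eventually_prod_filter by blast
        obtain Q1 Q2 where Q: "eventually Q1 F1" "eventually Q2 F2"
          "\<And>x y. Q1 x \<Longrightarrow> Q2 y \<Longrightarrow> (x, y) \<in> E V'"
          using n2 unfolding near_def eventually_prod_filter by blast
        have "eventually (\<lambda>x. P2 x \<and> Q1 x) F1" using P Q by (simp add: eventually_conj)
        moreover have "F1 \<noteq> bot" using KC[OF F1] by (simp add: Cauchy_for_def)
        ultimately obtain y where "P2 y" "Q1 y" using eventually_happens' by blast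
        then have "\<And>x z. P1 x \<Longrightarrow> Q2 z \<Longrightarrow> (x, z) \<in> E V" using P(3) Q(3) V'(2) by blast
        then show ?thesis unfolding near_def eventually_prod_filter using P(1) Q(2) by blast
      qed
      then show ?thesis using F1 V(2) V'(1) unfolding Op_def by blast
    qed
    then show "\<exists>V. eventually V (coset_uniformity G T H) \<and>
        (\<forall>F''\<in>K. eventually V (F' \<times>\<^sub>F F'') \<longrightarrow> F'' \<in> Op F)"
      using ev[OF V'(1)] unfolding near_def by (intro exI[of _ "\<lambda>p. p \<in> E V'"]) blast
  qed
  have "F \<in> Op F" if "F \<in> K" for F using that W(1) unfolding Op_def by blast
  then have "topspace (completion (coset_uniformity G T H)) \<subseteq> \<Union> (Op ` K)"
    by (auto simp: K_def)
  then obtain \<F> where \<F>: "finite \<F>" "\<F> \<subseteq> Op ` K" "K \<subseteq> \<Union>\<F>"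
    using cpt OpOpen unfolding co_precompact_def compact_space_alt
    by (metis (no_types, lifting) K_def imageE topspace_completion)
  then obtain L where L: "finite L" "L \<subseteq> K" "K \<subseteq> \<Union> (Op ` L)"
    using finite_subset_image[OF \<F>(1,2)] by metis
  have "\<exists>f. f \<in> carrier G \<and> (\<exists>P. eventually P F \<and> P (f <#\<^bsub>G\<^esub> H) \<and> (\<forall>A B. P A \<longrightarrow> P B \<longrightarrow> (A, B) \<in> E W))"
    if "F \<in> L" for F
  proof -
    have C: "Cauchy_for (coset_uniformity G T H) F" using KC L(2) that by blast
    then obtain P where P: "eventually P F" "\<forall>A B. P A \<longrightarrow> P B \<longrightarrow> (A, B) \<in> E W"
      using W(1) unfolding Cauchy_for_coset E_def by blast
    have "F \<noteq> bot" using C by (simp add: Cauchy_for_def)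
    then obtain A where A: "P A" using P(1) eventually_happens' by blast
    then have "(A, A) \<in> coset_entourage G H W" using P(2) unfolding E_def by blast
    then obtain f where "f \<in> carrier G" "A = f <#\<^bsub>G\<^esub> H" unfolding coset_entourage_def by blast
    then show ?thesis using A P by blast
  qed
  then obtain c where c: "\<And>F. F \<in> L \<Longrightarrow> c F \<in> carrier G"
    "\<And>F. F \<in> L \<Longrightarrow> \<exists>P. eventually P F \<and> P (c F <#\<^bsub>G\<^esub> H) \<and> (\<forall>A B. P A \<longrightarrow> P B \<longrightarrow> (A, B) \<in> E W)"
    by metis
  have U0G: "U\<^sub>0 \<subseteq> carrier G" using openin_subset[OF U0(1)] topspace_eq by simp
  have HG: "H \<subseteq> carrier G" using H by (rule subgroup.subset)
  have cover: "g \<in> U\<^sub>0 <#> c ` L <#> H" if g: "g \<in> carrier G" for g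
  proof -
    obtain N where N: "N \<in> K" "\<And>P. eventually P N \<Longrightarrow> P (g <#\<^bsub>G\<^esub> H)"
      using coset_nhds_point[OF H g] unfolding K_def by blast
    then obtain F where F: "F \<in> L" "N \<in> Op F" using L(3) by blast
    then have "near W F N" using near_refl N(1) unfolding Op_def by blast
    then obtain P Q where PQ: "eventually P F" "eventually Q N" "\<And>x y. P x \<Longrightarrow> Q y \<Longrightarrow> (x, y) \<in> E W"
      unfolding near_def eventually_prod_filter by blast
    obtain R where R: "eventually R F" "R (c F <#\<^bsub>G\<^esub> H)" "\<forall>A B. R A \<longrightarrow> R B \<longrightarrow> (A, B) \<in> E W"
      using c(2)[OF F(1)] by blast
    have "F \<noteq> bot" using KC L(2) F(1) unfolding Cauchy_for_def by blast
    moreover have "eventually (\<lambda>x. P x \<and> R x) F" using PQ R by (simp add: eventually_conj)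
    ultimately obtain B where B: "P B" "R B" using eventually_happens' by blast
    have "(B, g <#\<^bsub>G\<^esub> H) \<in> E W" using PQ B N(2) by blast
    then have "(g <#\<^bsub>G\<^esub> H, B) \<in> E W" using coset_entourage_sym[OF H W(1)] by (simp add: E_def)
    moreover have "(B, c F <#\<^bsub>G\<^esub> H) \<in> E W" using R B by blast
    ultimately have "(g <#\<^bsub>G\<^esub> H, c F <#\<^bsub>G\<^esub> H) \<in> coset_entourage G H U\<^sub>0" using W(2) by (simp add: E_def)
    then obtain k u where ku: "k \<in> carrier G" "c F <#\<^bsub>G\<^esub> H = k <#\<^bsub>G\<^esub> H" "u \<in> U\<^sub>0" "g <#\<^bsub>G\<^esub> H = (u \<otimes> k) <#\<^bsub>G\<^esub> H"
      unfolding coset_entourage_iff[OF H U0G] by blast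
    have uG: "u \<in> carrier G" using ku(3) U0G by blast
    have "g <#\<^bsub>G\<^esub> H = u <#\<^bsub>G\<^esub> (c F <#\<^bsub>G\<^esub> H)" using ku uG by (simp add: lcos_m_assoc[OF HG])
    moreover have "g \<in> g <#\<^bsub>G\<^esub> H"
      using g subgroup.one_closed[OF H] unfolding l_coset_def by force
    ultimately obtain h where "h \<in> H" "g = u \<otimes> (c F \<otimes> h)" unfolding l_coset_def by blast
    moreover have "u \<otimes> (c F \<otimes> h) = u \<otimes> c F \<otimes> h"
      using uG c(1)[OF F(1)] HG \<open>h \<in> H\<close> by (auto simp: m_assoc)
    ultimately show ?thesis using ku(3) F(1) unfolding set_mult_def by blast
  qed
  have cL: "c ` L \<subseteq> carrier G" using c(1) by blast
  then have "U\<^sub>0 <#> c ` L <#> H \<subseteq> carrier G" using U0G HG by (simp add: set_mult_closed)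
  then have "U\<^sub>0 <#> c ` L <#> H = carrier G" using cover by blast
  then show ?thesis using L(1) cL by blast
qed

end

end

theory Submission
  imports Defs
begin

text \<open>Let \<open>AP\<^sub>G\<close> and \<open>AP\<^sub>H\<close> be the sets of almost periodic points of a \<open>G\<close>-flow \<open>X\<close> for
  the actions of \<open>G\<close> and of \<open>H\<close>, and let \<open>x\<close> be a limit of points of \<open>AP\<^sub>G\<close>.

  Every minimal \<open>G\<close>-subflow is an \<open>H\<close>-flow, so it contains points of \<open>AP\<^sub>H\<close>, and the \<open>G\<close>-orbit of
  each of them is dense in it.  Hence every neighbourhood of \<open>x\<close> meets the \<open>G\<close>-orbit of some
  \<open>y \<in> AP\<^sub>H\<close>.  Let \<open>z\<close> be a cluster point of such points \<open>y\<close> as the neighbourhood shrinks to \<open>x\<close>.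
  Since \<open>H\<close> is CAP, \<open>z \<in> AP\<^sub>H\<close>, and pre-syndeticity gives \<open>AP\<^sub>H \<subseteq> AP\<^sub>G\<close>
  (\<open>pre_syndetic_AP_subset\<close>), so the closure of \<open>G z\<close> is minimal.  It remains to see that \<open>x\<close>
  lies in this closure.

  Suppose not.  By compactness there is a neighbourhood \<open>U\<close> of the identity such that \<open>U\<close> does not
  move points near the closure of \<open>G z\<close> to points near \<open>x\<close>.  Co-precompactness gives
  a finite \<open>F\<close> with \<open>G = U F H\<close>, so there are \<open>y \<in> AP\<^sub>H\<close> arbitrarily close to \<open>z\<close> and
  \<open>u f h \<in> U F H\<close> with \<open>u f h y\<close> close to \<open>x\<close>.  Let \<open>w\<close> be a cluster point of the points \<open>h y\<close>.
  If \<open>w\<close> is in the closure of \<open>H z\<close>, then \<open>f w\<close> is in the closure of \<open>G z\<close> for each of the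
  finitely many \<open>f\<close>, so some \<open>f h y\<close> is near this closure and \<open>u\<close> moves it close to \<open>x\<close>,
  which is a contradiction.

  The remaining point, that \<open>w\<close> is in the closure of \<open>H z\<close>, says that for a CAP group the
  relation of lying in the same minimal subflow is closed (\<open>CAP_same_minimal_subflow_closed\<close>).
  If it is not, then a continuous function \<open>f\<close> that separates the two minimal subflows in
  the limit gives, on one suitable minimal flow, functions with a common modulus of uniform continuity
  along the group: for every finite set \<open>E\<close> of group elements, one that is close to \<open>0\<close> on \<open>E p\<close>
  and close to \<open>1\<close> on \<open>E q\<close> for some points \<open>p\<close> and \<open>q\<close>.  Such functions can be chosen
  one after the other so that bump functions with disjoint supports can be built from them
  (\<open>CAP_no_independent_family\<close>).  These bumps tend to \<open>0\<close> pointwise but not uniformly.  This is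
  impossible for a CAP group (\<open>CAP_pointwise_decay_imp_uniform\<close>): by the Baire category theorem the
  bumps would restrict to almost periodic functions on the group with a nonzero limit whose orbit
  closure contains the zero function.\<close>

section \<open>Minimal subflows and almost periodic points\<close>

abbreviation orbit_closure ::
  "('a, 'b) monoid_scheme \<Rightarrow> 'x topology \<Rightarrow> ('a \<Rightarrow> 'x \<Rightarrow> 'x) \<Rightarrow> 'x \<Rightarrow> 'x set" where
  "orbit_closure G X \<phi> x \<equiv> X closure_of (orbit G \<phi> x)"

text \<open>Compactness for filter bases; the families used below are indexed by neighbourhoods, by the
  tails of a sequence, or by finite subsets of the group.\<close>

lemma directed_cluster_point:
  assumes "compact_space X" and ne: "\<B> \<noteq> {}"
    and sub: "\<And>B. B \<in> \<B> \<Longrightarrow> B \<noteq> {} \<and> B \<subseteq> topspace X"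
    and dir: "\<And>A B. A \<in> \<B> \<Longrightarrow> B \<in> \<B> \<Longrightarrow> \<exists>C\<in>\<B>. C \<subseteq> A \<inter> B"
  obtains p where "p \<in> topspace X" "\<And>B. B \<in> \<B> \<Longrightarrow> p \<in> X closure_of B"
proof -
  let ?C = "(\<lambda>B. X closure_of B) ` \<B>"
  have lower: "\<exists>C\<in>\<B>. C \<subseteq> \<Inter>\<F>" if "finite \<F>" "\<F> \<subseteq> \<B>" for \<F>
    using that
  proof (induction \<F>)
    case empty
    then show ?case using ne by auto
  next
    case (insert A \<F>)
    then obtain C where C: "C \<in> \<B>" "C \<subseteq> \<Inter>\<F>" by blast
    have "A \<in> \<B>" using insert.prems by blast
    from dir[OF this C(1)] obtain D where "D \<in> \<B>" "D \<subseteq> A \<inter> C" by (rule bexE)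
    moreover from this C(2) have "D \<subseteq> \<Inter>(insert A \<F>)" by blast
    ultimately show ?case by blast
  qed
  have "\<Inter>\<F> \<noteq> {}" if "finite \<F>" "\<F> \<subseteq> ?C" for \<F>
  proof -
    from finite_subset_image[OF that]
    obtain \<A> where \<A>: "finite \<A>" "\<A> \<subseteq> \<B>" "\<F> = (\<lambda>B. X closure_of B) ` \<A>"
      by blast
    obtain C where C: "C \<in> \<B>" "C \<subseteq> \<Inter>\<A>" using lower[OF \<A>(1,2)] by blast
    have "C \<subseteq> X closure_of B" if "B \<in> \<A>" for B
      using that C \<A>(2) sub[of B] closure_of_subset[of B X] by blast
    then show ?thesis using sub[OF C(1)] \<A>(3) by blast
  qed
  moreover have "\<forall>C\<in>?C. closedin X C" by simp
  ultimately have "\<Inter>?C \<noteq> {}"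
    using assms(1) unfolding compact_space_fip by (metis (no_types, lifting))
  then obtain p where p: "p \<in> \<Inter>?C" by blast
  moreover have "p \<in> topspace X"
    using p ne closure_of_subset_topspace[of X] by blast
  ultimately show ?thesis using that by blast
qed

locale tg_flow = flow G T X \<phi> + tg: topological_group G T
  for G (structure) and T :: "'a topology" and X :: "'x topology" and \<phi>
begin

lemma act_inv:
  assumes "g \<in> carrier G" "x \<in> topspace X"
  shows "\<phi> (inv g) (\<phi> g x) = x" "\<phi> g (\<phi> (inv g) x) = x"
  using assms act_mult[OF assms(2), of "inv g" g] act_mult[OF assms(2), of g "inv g"] act_one
  by auto

lemma openin_act_preimage:
  assumes "g \<in> carrier G" "openin X V"
  shows "openin X {x \<in> topspace X. \<phi> g x \<in> V}"
  using act_continuous[OF assms(1) tg.topspace_eq] assms(2) by (rule openin_continuous_map_preimage)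

lemma openin_finite_act_preimage:
  assumes "finite F" "F \<subseteq> carrier G" "openin X V"
  shows "openin X {x \<in> topspace X. \<forall>g\<in>F. \<phi> g x \<in> V}"
  using assms
proof (induction F)
  case (insert g F)
  have "{x \<in> topspace X. \<forall>h\<in>insert g F. \<phi> h x \<in> V}
      = {x \<in> topspace X. \<phi> g x \<in> V} \<inter> {x \<in> topspace X. \<forall>h\<in>F. \<phi> h x \<in> V}" by auto
  then show ?case using insert openin_act_preimage[of g V] by (simp add: openin_Int)
qed simp

lemma subflow_subset: "subflow G X \<phi> Y \<Longrightarrow> Y \<subseteq> topspace X"
  unfolding subflow_def using closedin_subset by blast

lemma orbit_closure_subset: "orbit_closure G X \<phi> x \<subseteq> topspace X"
  by (rule closure_of_subset_topspace)

lemma self_in_orbit_closure: "x \<in> topspace X \<Longrightarrow> x \<in> orbit_closure G X \<phi> x"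
  using in_orbit closure_of_subset[OF orbit_subset] by blast

lemma subflow_orbit_closure: "x \<in> topspace X \<Longrightarrow> subflow G X \<phi> (orbit_closure G X \<phi> x)"
  using subflow_closure_orbit tg.topspace_eq by blast

lemma orbit_closure_mono:
  assumes "x \<in> topspace X" "y \<in> orbit_closure G X \<phi> x"
  shows "orbit_closure G X \<phi> y \<subseteq> orbit_closure G X \<phi> x"
  using closure_orbit_least[OF subflow_orbit_closure] assms by blast

lemma orbit_meets_neighbourhood:
  assumes "y \<in> orbit_closure G X \<phi> x" "openin X V" "y \<in> V"
  obtains g where "g \<in> carrier G" "\<phi> g x \<in> V"
  using assms unfolding in_closure_of orbit_def by blast

lemma minimal_subflow_eq_orbit_closure:
  assumes "minimal_subflow G X \<phi> M" "x \<in> M"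
  shows "orbit_closure G X \<phi> x = M"
proof -
  have M: "subflow G X \<phi> M" using assms(1) by (simp add: minimal_subflow_def)
  then have "x \<in> topspace X" using subflow_subset assms(2) by blast
  then show ?thesis
    using assms subflow_orbit_closure closure_orbit_least[OF M assms(2)]
    unfolding minimal_subflow_def by blast
qed

lemma minimal_subflow_subset_AP:
  assumes "minimal_subflow G X \<phi> M"
  shows "M \<subseteq> AP G X \<phi>"
  using assms minimal_subflow_eq_orbit_closure[OF assms] subflow_subset[of M]
  unfolding AP_def minimal_subflow_def by auto

lemma AP_subset: "AP G X \<phi> \<subseteq> topspace X"
  by (auto simp: AP_def)

lemma AP_minimal: "x \<in> AP G X \<phi> \<Longrightarrow> minimal_subflow G X \<phi> (orbit_closure G X \<phi> x)"
  by (simp add: AP_def)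

lemma AP_orbit_closure:
  assumes "x \<in> AP G X \<phi>" "y \<in> orbit_closure G X \<phi> x"
  shows "y \<in> AP G X \<phi>" "orbit_closure G X \<phi> y = orbit_closure G X \<phi> x"
  using minimal_subflow_subset_AP[OF AP_minimal] minimal_subflow_eq_orbit_closure[OF AP_minimal] assms
  by blast+

text \<open>Orbit closures in the orbit closure of \<open>x\<close> cannot be smaller if each of them returns to \<open>x\<close>.\<close>

lemma AP_I:
  assumes "x \<in> topspace X"
    and rec: "\<And>y. y \<in> orbit_closure G X \<phi> x \<Longrightarrow> x \<in> orbit_closure G X \<phi> y"
  shows "x \<in> AP G X \<phi>"
proof -
  have "Z = orbit_closure G X \<phi> x"
    if Z: "subflow G X \<phi> Z" "Z \<subseteq> orbit_closure G X \<phi> x" for Z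
  proof -
    obtain y where y: "y \<in> Z" using Z(1) unfolding subflow_def by blast
    then have "x \<in> Z" using rec Z(2) closure_orbit_least[OF Z(1) y] by blast
    then show ?thesis using closure_orbit_least[OF Z(1)] Z(2) by blast
  qed
  then show ?thesis
    using assms(1) subflow_orbit_closure unfolding AP_def minimal_subflow_def by blast
qed

lemma act_in_orbit_closure:
  assumes "x \<in> topspace X" "g \<in> carrier G"
  shows "\<phi> g x \<in> orbit_closure G X \<phi> x"
  using subflow_orbit_closure[OF assms(1)] self_in_orbit_closure[OF assms(1)] assms(2)
  unfolding subflow_def by blast

lemma AP_act: "x \<in> AP G X \<phi> \<Longrightarrow> g \<in> carrier G \<Longrightarrow> \<phi> g x \<in> AP G X \<phi>"
  using AP_orbit_closure(1) act_in_orbit_closure AP_subset by blast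

text \<open>Zorn's lemma is applied to the complements, so that maximal elements are minimal subflows.
  Intersections of chains are nonempty by compactness.\<close>

lemma minimal_subflow_exists:
  assumes Y: "subflow G X \<phi> Y"
  obtains M where "minimal_subflow G X \<phi> M" "M \<subseteq> Y"
proof -
  define S where "S = {Z. subflow G X \<phi> Z \<and> Z \<subseteq> Y}"
  have ne: "uminus ` S \<noteq> {}" using Y by (auto simp: S_def)
  have "\<Union>\<C> \<in> uminus ` S" if ch: "\<C> \<noteq> {}" "subset.chain (uminus ` S) \<C>" for \<C>
  proof -
    define \<D> where "\<D> = uminus ` \<C>"
    have DS: "\<D> \<subseteq> S" using ch(2) by (auto simp: \<D>_def subset_chain_def)
    have Dne: "\<D> \<noteq> {}" using ch(1) by (simp add: \<D>_def)
    have Dch: "A \<subseteq> B \<or> B \<subseteq> A" if AB: "A \<in> \<D>" "B \<in> \<D>" for A B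
    proof -
      have "- A \<in> \<C>" "- B \<in> \<C>" using AB by (auto simp: \<D>_def)
      then have "- A \<subseteq> - B \<or> - B \<subseteq> - A" using ch(2) unfolding subset_chain_def by blast
      then show ?thesis by auto
    qed
    have Dsub: "subflow G X \<phi> Z" "Z \<subseteq> Y" "closedin X Z" if "Z \<in> \<D>" for Z
      using that DS by (auto simp: S_def subflow_def)
    have "B \<noteq> {} \<and> B \<subseteq> topspace X" if "B \<in> \<D>" for B
      using Dsub(1)[OF that] subflow_subset by (auto simp: subflow_def)
    moreover have "\<exists>C\<in>\<D>. C \<subseteq> A \<inter> B" if "A \<in> \<D>" "B \<in> \<D>" for A B
      using Dch[OF that] that by blast
    ultimately obtain p where p: "\<And>B. B \<in> \<D> \<Longrightarrow> p \<in> X closure_of B"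
      using directed_cluster_point[OF compact Dne] by metis
    have "p \<in> \<Inter>\<D>" using p Dsub(3) closure_of_closedin by blast
    moreover have "closedin X (\<Inter>\<D>)" using Dne Dsub(3) by (rule closedin_Inter)
    moreover have "\<Inter>\<D> \<subseteq> Y" using Dne Dsub(2) by blast
    ultimately have "\<Inter>\<D> \<in> S"
      using Dsub(1) unfolding S_def subflow_def by blast
    moreover have "\<Union>\<C> = - \<Inter>\<D>" by (auto simp: \<D>_def)
    ultimately show ?thesis by blast
  qed
  then obtain N where N: "N \<in> uminus ` S" "\<And>Z. Z \<in> uminus ` S \<Longrightarrow> N \<subseteq> Z \<Longrightarrow> Z = N"
    using subset_Zorn_nonempty[OF ne] by metis
  define M where "M = - N"
  have "M \<in> S" using N(1) by (auto simp: M_def)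
  moreover have "Z = M" if "subflow G X \<phi> Z" "Z \<subseteq> M" for Z
  proof -
    have "Z \<in> S" using that \<open>M \<in> S\<close> by (auto simp: S_def)
    then have "- Z = N" using N(2)[of "- Z"] that(2) by (auto simp: M_def)
    then show ?thesis by (auto simp: M_def)
  qed
  ultimately have "minimal_subflow G X \<phi> M" "M \<subseteq> Y"
    unfolding minimal_subflow_def S_def by auto
  then show ?thesis by (rule that)
qed

text \<open>The preimages of the open set under the group elements cover the minimal subflow, since every
  orbit in it is dense.\<close>

lemma minimal_subflow_finite_return:
  assumes M: "minimal_subflow G X \<phi> M" and P: "openin X P" and q: "q \<in> M" "q \<in> P"
  obtains E where "finite E" "E \<subseteq> carrier G" "\<And>x. x \<in> M \<Longrightarrow> \<exists>e\<in>E. \<phi> e x \<in> P"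
proof -
  have sub: "subflow G X \<phi> M" using M by (simp add: minimal_subflow_def)
  have cpt: "compactin X M"
    using sub compact closedin_compact_space by (auto simp: subflow_def)
  define \<U> where "\<U> = (\<lambda>g. {x \<in> topspace X. \<phi> g x \<in> P}) ` carrier G"
  have "M \<subseteq> \<Union>\<U>"
  proof
    fix x assume x: "x \<in> M"
    then obtain g where "g \<in> carrier G" "\<phi> g x \<in> P"
      using orbit_meets_neighbourhood[OF _ P q(2)] minimal_subflow_eq_orbit_closure[OF M x] q(1) by blast
    then show "x \<in> \<Union>\<U>" using x subflow_subset[OF sub] by (auto simp: \<U>_def)
  qed
  moreover have "\<forall>U\<in>\<U>. openin X U" using openin_act_preimage[OF _ P] by (auto simp: \<U>_def)
  ultimately obtain \<F> where \<F>: "finite \<F>" "\<F> \<subseteq> \<U>" "M \<subseteq> \<Union>\<F>"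
    using cpt unfolding compactin_def by metis
  obtain E where E: "finite E" "E \<subseteq> carrier G" "\<F> = (\<lambda>g. {x \<in> topspace X. \<phi> g x \<in> P}) ` E"
    using finite_subset_image[OF \<F>(1) \<F>(2)[unfolded \<U>_def]] by (elim exE conjE)
  show ?thesis by (rule that[OF E(1,2)]) (use \<F>(3) E(3) in blast)
qed

text \<open>The tube lemma turns continuity of the action at \<open>{\<one>} \<times> A\<close> into one neighbourhood \<open>U\<close> of
  the identity that is small for all points near \<open>A\<close>.\<close>

lemma neighbourhood_separation:
  assumes A: "closedin X A" and B: "closedin X B" and dis: "A \<inter> B = {}"
  obtains U P N where "openin T U" "\<one> \<in> U" "openin X P" "A \<subseteq> P" "openin X N" "B \<subseteq> N"
    "\<And>u x. u \<in> U \<Longrightarrow> x \<in> P \<Longrightarrow> \<phi> u x \<notin> N"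
proof -
  have "normal_space X"
    using compact Hausdorff by (simp add: compact_Hausdorff_or_regular_imp_normal_space)
  then obtain P' N where PN: "openin X P'" "openin X N" "A \<subseteq> P'" "B \<subseteq> N" "disjnt P' N"
    using A B dis unfolding normal_space_def disjnt_def by metis
  define W where "W = {p \<in> topspace (prod_topology T X). (case p of (g, x) \<Rightarrow> \<phi> g x) \<in> P'}"
  have W: "openin (prod_topology T X) W"
    unfolding W_def using continuous_action PN(1) by (rule openin_continuous_map_preimage)
  have cA: "compactin X A" using compact A by (simp add: closedin_compact_space)
  have one: "\<one> \<in> topspace T" using tg.topspace_eq by simp
  have sub: "{\<one>} \<times> A \<subseteq> W"
    using PN(3) one closedin_subset[OF A] by (auto simp: W_def act_one subset_iff)
  from tube_lemma_right[OF W cA one sub]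
  obtain U P where "openin T U" "openin X P" "\<one> \<in> U" "A \<subseteq> P" "U \<times> P \<subseteq> W"
    by (elim exE conjE)
  moreover from this have "\<phi> u x \<notin> N" if "u \<in> U" "x \<in> P" for u x
    using that PN(5) unfolding W_def disjnt_def by auto
  ultimately show ?thesis using PN that by blast
qed

text \<open>Compactness of \<open>X\<close> makes continuity of the action at the identity uniform in the points.\<close>

lemma uniform_modulus:
  assumes f: "continuous_map X euclideanreal f" and \<epsilon>: "0 < \<epsilon>"
  obtains U where "openin T U" "\<one> \<in> U" "\<And>u x. u \<in> U \<Longrightarrow> x \<in> topspace X \<Longrightarrow> \<bar>f (\<phi> u x) - f x\<bar> < \<epsilon>"
proof -
  define W where "W = {p \<in> topspace (prod_topology T X).
      (case p of (g, x) \<Rightarrow> f (\<phi> g x) - f x) \<in> {-\<epsilon><..<\<epsilon>}}"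
  have "continuous_map (prod_topology T X) euclideanreal (\<lambda>p. f ((\<lambda>(g, x). \<phi> g x) p) - f (snd p))"
    using continuous_map_compose[OF continuous_action f] continuous_map_compose[OF continuous_map_snd f]
    by (intro continuous_map_diff) (simp_all add: o_def)
  then have "continuous_map (prod_topology T X) euclideanreal (\<lambda>(g, x). f (\<phi> g x) - f x)"
    by (rule continuous_map_eq) auto
  then have W: "openin (prod_topology T X) W"
    unfolding W_def by (rule openin_continuous_map_preimage) auto
  have one: "\<one> \<in> topspace T" using tg.topspace_eq by simp
  have sub: "{\<one>} \<times> topspace X \<subseteq> W" using one act_one \<epsilon> by (auto simp: W_def)
  have "compactin X (topspace X)" using compact by (simp add: compact_space_def)
  from tube_lemma_right[OF W this one sub]
  obtain U P where "openin T U" "\<one> \<in> U" "topspace X \<subseteq> P" "U \<times> P \<subseteq> W"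
    by (elim exE conjE)
  moreover from this have "\<bar>f (\<phi> u x) - f x\<bar> < \<epsilon>" if "u \<in> U" "x \<in> topspace X" for u x
  proof -
    have "(u, x) \<in> W" using that \<open>topspace X \<subseteq> P\<close> \<open>U \<times> P \<subseteq> W\<close> by blast
    then show ?thesis by (auto simp: W_def abs_less_iff)
  qed
  ultimately show ?thesis using that by blast
qed

end


context tg_flow
begin

lemma orbit_closure_image:
  assumes Y: "tg_flow G T Y \<psi>" and cont: "continuous_map X Y \<pi>"
    and equi: "\<And>g z. g \<in> carrier G \<Longrightarrow> z \<in> topspace X \<Longrightarrow> \<pi> (\<phi> g z) = \<psi> g (\<pi> z)"
    and x: "x \<in> topspace X"
  shows "orbit_closure G Y \<psi> (\<pi> x) = \<pi> ` orbit_closure G X \<phi> x"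
proof -
  interpret Y: tg_flow G T Y \<psi> by fact
  have "closed_map X Y \<pi>" using continuous_imp_closed_map[OF cont compact Y.Hausdorff] .
  then have "Y closure_of (\<pi> ` orbit G \<phi> x) \<subseteq> \<pi> ` orbit_closure G X \<phi> x"
    using orbit_subset[OF x] by (simp add: closed_map_closure_of_image)
  moreover have "\<pi> ` orbit_closure G X \<phi> x \<subseteq> Y closure_of (\<pi> ` orbit G \<phi> x)"
    using cont by (auto simp: continuous_map_eq_image_closure_subset)
  moreover have "orbit G \<psi> (\<pi> x) = \<pi> ` orbit G \<phi> x"
    unfolding orbit_def using equi[OF _ x] by (auto simp: image_iff) metis
  ultimately show ?thesis by simp
qed

text \<open>Orbit closures map onto orbit closures, so recurrence passes to the image.\<close>

lemma AP_image:
  assumes Y: "tg_flow G T Y \<psi>" and cont: "continuous_map X Y \<pi>"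
    and equi: "\<And>g z. g \<in> carrier G \<Longrightarrow> z \<in> topspace X \<Longrightarrow> \<pi> (\<phi> g z) = \<psi> g (\<pi> z)"
    and x: "x \<in> AP G X \<phi>"
  shows "\<pi> x \<in> AP G Y \<psi>"
proof -
  interpret Y: tg_flow G T Y \<psi> by fact
  have xX: "x \<in> topspace X" using x AP_subset by blast
  note img = orbit_closure_image[OF Y cont equi]
  show ?thesis
  proof (rule Y.AP_I)
    show "\<pi> x \<in> topspace Y" using continuous_map_image_subset_topspace[OF cont] xX by blast
    fix y assume "y \<in> orbit_closure G Y \<psi> (\<pi> x)"
    then obtain z where z: "y = \<pi> z" "z \<in> orbit_closure G X \<phi> x" using img xX by blast
    then have "z \<in> topspace X" using orbit_closure_subset by blast
    moreover have "x \<in> orbit_closure G X \<phi> z"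
      using AP_orbit_closure(2)[OF x z(2)] self_in_orbit_closure[OF xX] by simp
    ultimately show "\<pi> x \<in> orbit_closure G Y \<psi> y" using img z(1) by blast
  qed
qed

end

section \<open>The flow of functions with a given modulus of uniform continuity\<close>

context topological_group
begin

lemma continuous_map_left_mult:
  assumes "a \<in> carrier G"
  shows "continuous_map T T (\<lambda>g. a \<otimes> g)"
proof -
  have "continuous_map T (prod_topology T T) (\<lambda>g. (a, g))"
    using assms topspace_eq by (auto intro: continuous_intros)
  from continuous_map_compose[OF this continuous_mult] show ?thesis by (simp add: o_def)
qed

lemma continuous_map_right_mult:
  assumes "a \<in> carrier G"
  shows "continuous_map T T (\<lambda>g. g \<otimes> a)"
proof -
  have "continuous_map T (prod_topology T T) (\<lambda>g. (g, a))"
    using assms topspace_eq by (auto intro: continuous_intros)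
  from continuous_map_compose[OF this continuous_mult] show ?thesis by (simp add: o_def)
qed

text \<open>The value \<open>\<omega> u\<close> is to bound the change of a function when its argument is moved by \<open>u\<close>.\<close>

definition modulus :: "('a \<Rightarrow> real) \<Rightarrow> bool" where
  "modulus \<omega> \<longleftrightarrow> (\<forall>u. 0 \<le> \<omega> u) \<and> (\<forall>\<epsilon>>0. \<exists>U. openin T U \<and> \<one> \<in> U \<and> (\<forall>u\<in>U. \<omega> u < \<epsilon>))"

text \<open>Bounding the change under left multiplication makes the action by right translation jointly
  continuous for the topology of pointwise convergence: moving from \<open>k \<otimes> g\<^sub>0\<close> to \<open>k \<otimes> g\<close> is left
  multiplication by \<open>k \<otimes> g \<otimes> inv (k \<otimes> g\<^sub>0)\<close>, which is near the identity if \<open>g\<close> is near \<open>g\<^sub>0\<close>.\<close>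

definition equi_functions :: "('a \<Rightarrow> real) \<Rightarrow> ('a \<Rightarrow> real) set" where
  "equi_functions \<omega> = {p \<in> carrier G \<rightarrow>\<^sub>E {0..1}.
     \<forall>u\<in>carrier G. \<forall>h\<in>carrier G. \<bar>p (u \<otimes> h) - p h\<bar> \<le> \<omega> u}"

definition equi_topology :: "('a \<Rightarrow> real) \<Rightarrow> ('a \<Rightarrow> real) topology" where
  "equi_topology \<omega> = subtopology (product_topology (\<lambda>_. euclideanreal) (carrier G)) (equi_functions \<omega>)"

definition translate :: "('a \<Rightarrow> real) \<Rightarrow> 'a \<Rightarrow> ('a \<Rightarrow> real) \<Rightarrow> 'a \<Rightarrow> real" where
  "translate \<omega> g = (\<lambda>p\<in>equi_functions \<omega>. \<lambda>k\<in>carrier G. p (k \<otimes> g))"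

lemma topspace_equi_topology [simp]: "topspace (equi_topology \<omega>) = equi_functions \<omega>"
  by (auto simp: equi_topology_def equi_functions_def PiE_def)

lemma translate_apply:
  "p \<in> equi_functions \<omega> \<Longrightarrow> k \<in> carrier G \<Longrightarrow> translate \<omega> g p k = p (k \<otimes> g)"
  by (simp add: translate_def)

lemma translate_closed:
  assumes p: "p \<in> equi_functions \<omega>" and g: "g \<in> carrier G"
  shows "translate \<omega> g p \<in> equi_functions \<omega>"
proof -
  have "\<bar>p (u \<otimes> h \<otimes> g) - p (h \<otimes> g)\<bar> \<le> \<omega> u" if "u \<in> carrier G" "h \<in> carrier G" for u h
  proof -
    have "\<bar>p (u \<otimes> (h \<otimes> g)) - p (h \<otimes> g)\<bar> \<le> \<omega> u"
      using p that g unfolding equi_functions_def by auto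
    then show ?thesis using that g by (simp add: m_assoc)
  qed
  then show ?thesis using p g by (auto simp: translate_def equi_functions_def PiE_iff)
qed

lemma continuous_map_eval:
  assumes "k \<in> carrier G"
  shows "continuous_map (equi_topology \<omega>) euclideanreal (\<lambda>p. p k)"
  unfolding equi_topology_def
  using assms by (intro continuous_map_from_subtopology continuous_map_product_projection)

lemma compact_equi_topology: "compact_space (equi_topology \<omega>)"
proof -
  let ?P = "product_topology (\<lambda>_::'a. euclideanreal) (carrier G)"
  have cpt: "compactin ?P (carrier G \<rightarrow>\<^sub>E {0..1})"
    by (simp add: compactin_PiE)
  have clo: "closedin ?P {p \<in> topspace ?P. \<bar>p (u \<otimes> h) - p h\<bar> \<in> {..\<omega> u}}"
    if "u \<in> carrier G" "h \<in> carrier G" for u h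
    using that
    by (intro closedin_continuous_map_preimage[of _ euclideanreal] continuous_map_real_abs
        continuous_map_diff continuous_map_product_projection) auto
  have "equi_functions \<omega> = \<Inter> ({carrier G \<rightarrow>\<^sub>E {0..1}} \<union>
      (\<lambda>(u, h). {p \<in> topspace ?P. \<bar>p (u \<otimes> h) - p h\<bar> \<in> {..\<omega> u}}) ` (carrier G \<times> carrier G))"
    (is "_ = \<Inter> ?K")
    by (auto simp: equi_functions_def PiE_iff extensional_def)
  moreover have "closedin ?P K" if "K \<in> ?K" for K
    using that clo by (auto simp: closedin_product_topology)
  then have "compactin ?P (\<Inter> ?K)"
    by (intro closed_compactin_Inter[OF cpt]) auto
  ultimately have "compactin ?P (equi_functions \<omega>)" by simp
  then show ?thesis
    unfolding equi_topology_def by (rule compact_space_subtopology)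
qed

lemma continuous_map_translate:
  assumes \<omega>: "modulus \<omega>"
  shows "continuous_map (prod_topology T (equi_topology \<omega>)) (equi_topology \<omega>)
    (\<lambda>(g, p). translate \<omega> g p)"
proof -
  let ?L = "equi_topology \<omega>"
  have eval: "continuous_map (prod_topology T ?L) euclideanreal (\<lambda>(g, p). p (k \<otimes> g))"
    if k: "k \<in> carrier G" for k
    unfolding Met_TC.continuous_map_to_metric[unfolded mtopology_is_euclidean]
  proof (intro ballI allI impI)
    fix x and \<epsilon> :: real assume "x \<in> topspace (prod_topology T ?L)" and \<epsilon>: "0 < \<epsilon>"
    then obtain g0 p0 where x: "x = (g0, p0)" "g0 \<in> carrier G" "p0 \<in> equi_functions \<omega>"
      using topspace_eq by auto
    obtain U where U: "openin T U" "\<one> \<in> U" "\<forall>u\<in>U. \<omega> u < \<epsilon> / 2"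
      using \<omega> \<epsilon> unfolding modulus_def by (meson half_gt_zero)
    define c where "c = inv (k \<otimes> g0)"
    have cG: "c \<in> carrier G" using k x by (simp add: c_def)
    define N1 where "N1 = {g \<in> topspace T. (k \<otimes> g) \<otimes> c \<in> U}"
    have "continuous_map T T (\<lambda>g. (k \<otimes> g) \<otimes> c)"
      using continuous_map_compose[OF continuous_map_left_mult[OF k] continuous_map_right_mult[OF cG]]
      by (simp add: o_def)
    then have N1: "openin T N1"
      unfolding N1_def using U(1) by (rule openin_continuous_map_preimage)
    define N2 where "N2 = {p \<in> topspace ?L. p (k \<otimes> g0) \<in> ball (p0 (k \<otimes> g0)) (\<epsilon> / 2)}"
    have N2: "openin ?L N2"
      unfolding N2_def using continuous_map_eval[of "k \<otimes> g0"] k x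
      by (intro openin_continuous_map_preimage[where Y = euclideanreal]) auto
    have "x \<in> N1 \<times> N2"
      using x k U(2) \<epsilon> topspace_eq by (simp add: N1_def N2_def c_def)
    moreover have "openin (prod_topology T ?L) (N1 \<times> N2)"
      using N1 N2 by (simp add: openin_prod_Times_iff)
    moreover have "(case y of (g, p) \<Rightarrow> p (k \<otimes> g)) \<in> Met_TC.mball (case x of (g, p) \<Rightarrow> p (k \<otimes> g)) \<epsilon>"
      if "y \<in> N1 \<times> N2" for y
    proof -
      from that obtain g p where y: "y = (g, p)" "g \<in> N1" "p \<in> N2" by blast
      have gG: "g \<in> carrier G" and u: "(k \<otimes> g) \<otimes> c \<in> U"
        using y topspace_eq by (auto simp: N1_def)
      have p: "p \<in> equi_functions \<omega>" and d: "\<bar>p (k \<otimes> g0) - p0 (k \<otimes> g0)\<bar> < \<epsilon> / 2"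
        using y by (auto simp: N2_def dist_real_def abs_minus_commute)
      have "(k \<otimes> g) \<otimes> c \<otimes> (k \<otimes> g0) = k \<otimes> g"
        using gG k x(2) by (simp add: c_def m_assoc)
      then have "\<bar>p (k \<otimes> g) - p (k \<otimes> g0)\<bar> \<le> \<omega> ((k \<otimes> g) \<otimes> c)"
        using p gG k x(2) cG unfolding equi_functions_def
        by (metis (mono_tags, lifting) m_closed mem_Collect_eq)
      then have "\<bar>p (k \<otimes> g) - p (k \<otimes> g0)\<bar> < \<epsilon> / 2" using U(3) u by force
      then have "\<bar>p (k \<otimes> g) - p0 (k \<otimes> g0)\<bar> < \<epsilon>" using d by linarith
      then show ?thesis using x y by (simp add: dist_real_def abs_minus_commute)
    qed
    ultimately show "\<exists>N. openin (prod_topology T ?L) N \<and> x \<in> N \<and>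
      (\<forall>y\<in>N. (case y of (g, p) \<Rightarrow> p (k \<otimes> g)) \<in> Met_TC.mball (case x of (g, p) \<Rightarrow> p (k \<otimes> g)) \<epsilon>)"
      by blast
  qed
  have "continuous_map (prod_topology T ?L) euclideanreal (\<lambda>x. (case x of (g, p) \<Rightarrow> translate \<omega> g p) k)"
    if k: "k \<in> carrier G" for k
    using eval[OF k] by (rule continuous_map_eq) (auto simp: translate_apply k)
  moreover have "(\<lambda>(g, p). translate \<omega> g p) ` topspace (prod_topology T ?L) \<subseteq> equi_functions \<omega>"
    using translate_closed topspace_eq by auto
  moreover from this have "(\<lambda>(g, p). translate \<omega> g p) ` topspace (prod_topology T ?L) \<subseteq> extensional (carrier G)"
    by (auto simp: equi_functions_def PiE_def)
  ultimately show ?thesis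
    unfolding equi_topology_def continuous_map_in_subtopology continuous_map_componentwise
    by (auto simp: equi_topology_def[symmetric])
qed

lemma zero_in_equi_functions: "modulus \<omega> \<Longrightarrow> (\<lambda>k\<in>carrier G. 0) \<in> equi_functions \<omega>"
  by (auto simp: equi_functions_def modulus_def)

lemma equi_flow:
  assumes \<omega>: "modulus \<omega>"
  shows "tg_flow G T (equi_topology \<omega>) (translate \<omega>)"
proof -
  have "group_action G (equi_functions \<omega>) (translate \<omega>)"
  proof (rule group_actionI)
    show "group G" by (rule is_group)
    show "translate \<omega> g \<in> extensional (equi_functions \<omega>)" for g by (simp add: translate_def)
    show "translate \<omega> \<one> p = p" if "p \<in> equi_functions \<omega>" for p
      using that by (auto simp: translate_def equi_functions_def PiE_def extensional_def)
    show "translate \<omega> (g \<otimes> h) p = translate \<omega> g (translate \<omega> h p)"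
      if "g \<in> carrier G" "h \<in> carrier G" "p \<in> equi_functions \<omega>" for g h p
      using that translate_closed[of p \<omega> h]
      by (auto simp: translate_def m_assoc fun_eq_iff)
  qed (rule translate_closed)
  moreover have "Hausdorff_space (equi_topology \<omega>)"
    unfolding equi_topology_def
    by (intro Hausdorff_space_subtopology) (simp add: Hausdorff_space_product_topology)
  ultimately show ?thesis
    using zero_in_equi_functions[OF \<omega>] compact_equi_topology continuous_map_translate[OF \<omega>]
      topological_group_axioms
    unfolding tg_flow_def flow_def flow_axioms_def by auto
qed

lemma closure_of_eval_le:
  assumes "p \<in> equi_topology \<omega> closure_of B" "k \<in> carrier G" "\<And>b. b \<in> B \<Longrightarrow> b \<in> equi_functions \<omega> \<Longrightarrow> b k \<le> c"
  shows "p k \<le> c"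
proof -
  have "closedin (equi_topology \<omega>) {p \<in> topspace (equi_topology \<omega>). p k \<in> {..c}}"
    by (rule closedin_continuous_map_preimage[OF continuous_map_eval[OF assms(2)]]) simp
  then have "equi_topology \<omega> closure_of (B \<inter> equi_functions \<omega>)
      \<subseteq> {p \<in> topspace (equi_topology \<omega>). p k \<in> {..c}}"
    using assms(3) by (intro closure_of_minimal) auto
  moreover have "p \<in> equi_topology \<omega> closure_of (B \<inter> equi_functions \<omega>)"
    using assms(1) closure_of_restrict[of "equi_topology \<omega>" B] by (simp add: Int_commute)
  ultimately show ?thesis by blast
qed

end

section \<open>Independent functions on a minimal flow of a CAP group\<close>

context tg_flow
begin

text \<open>Suppose that \<open>g n (xs n) \<ge> \<epsilon>\<close> for all \<open>n\<close>.  The functions \<open>k \<mapsto> g n (k xs n)\<close> on the group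
  are images of almost periodic points, so for a CAP group each of their cluster points \<open>q\<close> is
  almost periodic, and \<open>q \<one> \<ge> \<epsilon>\<close>.  Given a finite set \<open>F\<close>, Baire's theorem yields an open
  set of points \<open>x\<close> at which \<open>g n (k x)\<close> is small for all \<open>k \<in> F\<close> and all large \<open>n\<close> at once.  Finitely many group elements
  bring every point of \<open>M\<close> into this open set, and they do not depend on \<open>n\<close>, so some translate of
  \<open>q\<close> is small on \<open>F\<close>.  Hence the orbit closure of \<open>q\<close> contains the zero
  function, which is fixed, and almost periodicity forces \<open>q \<one> = 0\<close>.\<close>

lemma CAP_pointwise_decay_imp_uniform:
  assumes cap: "CAP TYPE('a \<Rightarrow> real) G T" and M: "minimal_subflow G X \<phi> M"
    and cont: "\<And>n::nat. continuous_map X euclideanreal (g n)"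
    and range: "\<And>n x. x \<in> topspace X \<Longrightarrow> g n x \<in> {0..1}"
    and \<omega>: "tg.modulus \<omega>"
    and equi: "\<And>n u x. u \<in> carrier G \<Longrightarrow> x \<in> topspace X \<Longrightarrow> \<bar>g n (\<phi> u x) - g n x\<bar> \<le> \<omega> u"
    and decay: "\<And>x. x \<in> M \<Longrightarrow> (\<lambda>n. g n x) \<longlonglongrightarrow> 0"
    and \<epsilon>: "0 < \<epsilon>"
  shows "\<exists>n. \<forall>x\<in>M. g n x < \<epsilon>"
proof (rule ccontr)
  assume "\<not> ?thesis"
  then obtain xs where xs: "\<And>n. xs n \<in> M" "\<And>n. \<epsilon> \<le> g n (xs n)"
    by (metis not_le)
  have MX: "M \<subseteq> topspace X" using M subflow_subset unfolding minimal_subflow_def by blast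
  have xsX: "xs n \<in> topspace X" for n using xs(1) MX by blast
  let ?L = "tg.equi_topology \<omega>" and ?\<psi> = "tg.translate \<omega>"
  interpret L: tg_flow G T ?L ?\<psi> using \<omega> by (rule tg.equi_flow)
  define \<pi> where "\<pi> n x = (\<lambda>k\<in>carrier G. g n (\<phi> k x))" for n x
  have \<pi>L: "\<pi> n x \<in> tg.equi_functions \<omega>" if "x \<in> topspace X" for n x
    using that range act_closed equi[of _ "\<phi> _ x" n]
    by (auto simp: \<pi>_def tg.equi_functions_def act_mult)
  have \<pi>cont: "continuous_map X ?L (\<pi> n)" for n
    unfolding tg.equi_topology_def continuous_map_in_subtopology continuous_map_componentwise
  proof (intro conjI ballI)
    show "\<pi> n ` topspace X \<subseteq> extensional (carrier G)" by (auto simp: \<pi>_def)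
    show "\<pi> n \<in> topspace X \<rightarrow> tg.equi_functions \<omega>" using \<pi>L by auto
    fix k assume k: "k \<in> carrier G"
    then show "continuous_map X euclideanreal (\<lambda>x. \<pi> n x k)"
      using continuous_map_compose[OF act_continuous[OF k tg.topspace_eq] cont]
      by (simp add: o_def \<pi>_def)
  qed
  have \<pi>equi: "\<pi> n (\<phi> h x) = ?\<psi> h (\<pi> n x)" if "h \<in> carrier G" "x \<in> topspace X" for n h x
    using that \<pi>L[OF that(2)] by (auto simp: tg.translate_def \<pi>_def act_mult fun_eq_iff)
  define p where "p n = \<pi> n (xs n)" for n
  have pL: "p n \<in> topspace ?L" for n using \<pi>L xsX by (simp add: p_def)
  have pAP: "p n \<in> AP G ?L ?\<psi>" for n
    unfolding p_def
    using AP_image[OF L.tg_flow_axioms \<pi>cont \<pi>equi] minimal_subflow_subset_AP[OF M] xs(1) by blast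
  obtain q where q: "q \<in> topspace ?L" "\<And>m. q \<in> ?L closure_of (p ` {m..})"
  proof (rule directed_cluster_point[OF L.compact, of "range (\<lambda>m. p ` {m..})"])
    show "B \<noteq> {} \<and> B \<subseteq> topspace ?L" if "B \<in> range (\<lambda>m. p ` {m..})" for B
      using that pL by auto
    fix A B assume "A \<in> range (\<lambda>m. p ` {m..})" "B \<in> range (\<lambda>m. p ` {m..})"
    then obtain m m' where mm': "A = p ` {m..}" "B = p ` {m'..}" by blast
    have "p ` {max m m'..} \<subseteq> A \<inter> B" unfolding mm' by auto
    then show "\<exists>C\<in>range (\<lambda>m. p ` {m..}). C \<subseteq> A \<inter> B" by blast
  qed auto
  have "closedin ?L (AP G ?L ?\<psi>)"
    using cap L.flow_axioms unfolding CAP_def by blast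
  then have "?L closure_of (p ` {0..}) \<subseteq> AP G ?L ?\<psi>"
    using pAP by (intro closure_of_minimal) auto
  then have qAP: "q \<in> AP G ?L ?\<psi>" using q(2) by blast
  have q1: "\<epsilon> \<le> q \<one>"
  proof -
    have "closedin ?L {r \<in> topspace ?L. r \<one> \<in> {\<epsilon>..}}"
      by (rule closedin_continuous_map_preimage[OF tg.continuous_map_eval]) auto
    moreover have "p n \<one> = g n (xs n)" for n using act_one[OF xsX] by (simp add: p_def \<pi>_def)
    ultimately have "?L closure_of (p ` {0..}) \<subseteq> {r \<in> topspace ?L. r \<one> \<in> {\<epsilon>..}}"
      using pL xs(2) by (intro closure_of_minimal) auto
    then show ?thesis using q(2) by blast
  qed
  \<comment> \<open>One finite set \<open>E\<close> of elements returning to the open set \<open>P\<close> from Baire's theorem serves all large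
    \<open>n\<close>, so the condition passes to the limit \<open>q\<close>.\<close>
  have small: "\<exists>e\<in>carrier G. \<forall>k\<in>F. q (k \<otimes> e) \<le> \<delta>"
    if F: "finite F" "F \<subseteq> carrier G" and \<delta>: "0 < \<delta>" for F \<delta>
  proof -
    define D where "D m = {x \<in> M. \<forall>n\<ge>m. \<forall>k\<in>F. g n (\<phi> k x) \<le> \<delta>}" for m
    let ?M = "subtopology X M"
    have tM: "topspace ?M = M" using MX by auto
    have "closedin X M" using M by (simp add: minimal_subflow_def subflow_def)
    then have cM: "compact_space ?M" and HM: "Hausdorff_space ?M"
      using compact Hausdorff
      by (auto simp: compact_space_subtopology closedin_compact_space Hausdorff_space_subtopology)
    have "closedin ?M (D m)" for m
    proof -
      have "closedin X {x \<in> topspace X. g n (\<phi> k x) \<in> {..\<delta>}}" if "k \<in> F" for n k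
      proof (rule closedin_continuous_map_preimage)
        have "k \<in> carrier G" using that F by blast
        then show "continuous_map X euclideanreal (\<lambda>x. g n (\<phi> k x))"
          using continuous_map_compose[OF act_continuous[OF _ tg.topspace_eq] cont] by (simp add: o_def)
      qed simp
      then have "closedin X (\<Inter> (insert (topspace X)
          ((\<lambda>(n, k). {x \<in> topspace X. g n (\<phi> k x) \<in> {..\<delta>}}) ` ({m..} \<times> F))))"
        by (intro closedin_Inter) auto
      moreover have "D m = M \<inter> (\<Inter> (insert (topspace X)
          ((\<lambda>(n, k). {x \<in> topspace X. g n (\<phi> k x) \<in> {..\<delta>}}) ` ({m..} \<times> F))))"
        using MX by (auto simp: D_def)
      ultimately show ?thesis by (simp add: closedin_subtopology_Int_closed)
    qed
    moreover have "(\<Union>m. D m) = M"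
    proof -
      have "\<exists>m. x \<in> D m" if x: "x \<in> M" for x
      proof -
        have "\<forall>k\<in>F. eventually (\<lambda>n. g n (\<phi> k x) < \<delta>) sequentially"
        proof
          fix k assume "k \<in> F"
          then have "\<phi> k x \<in> M" using F(2) M x unfolding minimal_subflow_def subflow_def by blast
          from order_tendstoD(2)[OF decay[OF this] \<delta>]
          show "eventually (\<lambda>n. g n (\<phi> k x) < \<delta>) sequentially" .
        qed
        then have "eventually (\<lambda>n. \<forall>k\<in>F. g n (\<phi> k x) < \<delta>) sequentially"
          using F(1) by (simp add: eventually_ball_finite)
        then obtain m where "\<And>n k. m \<le> n \<Longrightarrow> k \<in> F \<Longrightarrow> g n (\<phi> k x) < \<delta>"
          unfolding eventually_sequentially by blast
        then have "x \<in> D m" using x by (auto simp: D_def less_imp_le)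
        then show ?thesis by blast
      qed
      then show ?thesis by (auto simp: D_def)
    qed
    moreover have "?M interior_of M \<noteq> {}"
      using interior_of_topspace[of ?M] xs(1) unfolding tM by auto
    moreover have "locally_compact_space ?M \<and> regular_space ?M"
      using cM HM by (simp add: compact_imp_locally_compact_space compact_Hausdorff_imp_regular_space)
    ultimately obtain m where "?M interior_of (D m) \<noteq> {}"
      using Baire_category_alt[of ?M "range D"] by auto
    then obtain z where z: "z \<in> ?M interior_of (D m)" by blast
    obtain P where P: "openin X P" "?M interior_of (D m) = P \<inter> M"
      using openin_interior_of[of ?M "D m"] unfolding openin_subtopology by blast
    have PD: "P \<inter> M \<subseteq> D m" using P(2) interior_of_subset[of ?M "D m"] by blast
    have zP: "z \<in> M" "z \<in> P" using z P(2) by auto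
    obtain E where E: "finite E" "E \<subseteq> carrier G" "\<And>x. x \<in> M \<Longrightarrow> \<exists>e\<in>E. \<phi> e x \<in> P"
      using minimal_subflow_finite_return[OF M P(1) zP] by metis
    define S where "S e = {r \<in> topspace ?L. \<forall>k\<in>F. r (k \<otimes> e) \<le> \<delta>}" for e
    have "closedin ?L (S e)" if "e \<in> E" for e
    proof -
      have "closedin ?L {r \<in> topspace ?L. r (k \<otimes> e) \<in> {..\<delta>}}" if "k \<in> F" for k
        using that \<open>e \<in> E\<close> E(2) F(2)
        by (intro closedin_continuous_map_preimage[OF tg.continuous_map_eval]) auto
      then have "closedin ?L (\<Inter> (insert (topspace ?L) ((\<lambda>k. {r \<in> topspace ?L. r (k \<otimes> e) \<in> {..\<delta>}}) ` F)))"
        using closedin_topspace[of ?L] by (intro closedin_Inter) auto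
      moreover have "S e = \<Inter> (insert (topspace ?L) ((\<lambda>k. {r \<in> topspace ?L. r (k \<otimes> e) \<in> {..\<delta>}}) ` F))"
        by (auto simp: S_def)
      ultimately show ?thesis by simp
    qed
    then have "closedin ?L (\<Union> (S ` E))" using E(1) by (intro closedin_Union) auto
    moreover have "p ` {m..} \<subseteq> \<Union> (S ` E)"
    proof
      fix r assume "r \<in> p ` {m..}"
      then obtain n where n: "m \<le> n" "r = p n" by auto
      obtain e where e: "e \<in> E" "\<phi> e (xs n) \<in> P" using E(3)[OF xs(1)] by blast
      have eG: "e \<in> carrier G" using e(1) E(2) by blast
      have "\<phi> e (xs n) \<in> M" using eG M xs(1) unfolding minimal_subflow_def subflow_def by blast
      then have "\<phi> e (xs n) \<in> D m" using e(2) PD by blast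
      then have "g n (\<phi> k (\<phi> e (xs n))) \<le> \<delta>" if "k \<in> F" for k
        using that n(1) by (auto simp: D_def)
      then have "r (k \<otimes> e) \<le> \<delta>" if "k \<in> F" for k
        using that F(2) eG act_mult[OF xsX] by (auto simp: n(2) p_def \<pi>_def subset_iff)
      then show "r \<in> \<Union> (S ` E)" using e(1) pL n(2) by (auto simp: S_def)
    qed
    ultimately have "?L closure_of (p ` {m..}) \<subseteq> \<Union> (S ` E)" by (rule closure_of_minimal[rotated])
    then have "q \<in> \<Union> (S ` E)" using q(2) by blast
    then show ?thesis using E(2) unfolding S_def by blast
  qed
  define B where "B F \<delta> = {?\<psi> e q | e. e \<in> carrier G \<and> (\<forall>k\<in>F. q (k \<otimes> e) \<le> \<delta>)}" for F \<delta>
  let ?\<B> = "{B F \<delta> | F \<delta>. finite F \<and> F \<subseteq> carrier G \<and> 0 < \<delta>}"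
  \<comment> \<open>A function \<open>r \<le> 0\<close> in the orbit closure of \<open>q\<close>; it is zero, as functions in this flow are nonnegative.\<close>
  obtain r where r: "r \<in> topspace ?L" "\<And>C. C \<in> ?\<B> \<Longrightarrow> r \<in> ?L closure_of C"
  proof (rule directed_cluster_point[OF L.compact, of ?\<B>])
    have "B {} 1 \<in> ?\<B>" by (intro CollectI exI[of _ "{}"] exI[of _ 1]) auto
    then show "?\<B> \<noteq> {}" by blast
    show "C \<noteq> {} \<and> C \<subseteq> topspace ?L" if C: "C \<in> ?\<B>" for C
    proof -
      from C obtain F \<delta> where F: "C = B F \<delta>" "finite F" "F \<subseteq> carrier G" "0 < \<delta>" by blast
      have "B F \<delta> \<noteq> {}" using small[OF F(2-4)] unfolding B_def by blast
      moreover have "B F \<delta> \<subseteq> topspace ?L" using L.act_closed[OF _ q(1)] unfolding B_def by blast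
      ultimately show ?thesis using F(1) by simp
    qed
    fix C C' assume "C \<in> ?\<B>" "C' \<in> ?\<B>"
    then obtain F \<delta> F' \<delta>' where CC: "C = B F \<delta>" "finite F" "F \<subseteq> carrier G" "0 < \<delta>"
      "C' = B F' \<delta>'" "finite F'" "F' \<subseteq> carrier G" "0 < \<delta>'" by blast
    have "B (F \<union> F') (min \<delta> \<delta>') \<in> ?\<B>"
      using CC by (intro CollectI exI[of _ "F \<union> F'"] exI[of _ "min \<delta> \<delta>'"]) auto
    moreover have "B (F \<union> F') (min \<delta> \<delta>') \<subseteq> C \<inter> C'"
      unfolding CC B_def by auto
    ultimately show "\<exists>D\<in>?\<B>. D \<subseteq> C \<inter> C'" by blast
  qed auto
  have r_le: "r k \<le> \<delta>" if k: "k \<in> carrier G" and "0 < \<delta>" for k \<delta>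
  proof (rule tg.closure_of_eval_le[of r \<omega> "B {k} \<delta>"])
    show "r \<in> ?L closure_of B {k} \<delta>" using that by (intro r(2)) auto
    show "b k \<le> \<delta>" if "b \<in> B {k} \<delta>" for b
      using that k q(1) by (auto simp: B_def tg.translate_apply)
  qed fact
  have r0: "r k \<le> 0" if "k \<in> carrier G" for k
    using r_le[OF that] by (rule_tac field_le_epsilon) simp
  have "r \<in> ?L closure_of (B {} 1)"
    by (rule r(2), intro CollectI exI[of _ "{}"] exI[of _ 1]) auto
  moreover have "B {} 1 \<subseteq> orbit G ?\<psi> q" by (auto simp: B_def orbit_def)
  ultimately have "r \<in> orbit_closure G ?L ?\<psi> q" using closure_of_mono by blast
  then have "q \<in> orbit_closure G ?L ?\<psi> r"
    using L.AP_orbit_closure(2)[OF qAP] L.self_in_orbit_closure[OF q(1)] by blast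
  then have "q \<one> \<le> 0"
    using r0 r(1) by (rule_tac tg.closure_of_eval_le[of q \<omega> "orbit G ?\<psi> r"])
      (auto simp: orbit_def tg.translate_apply)
  then show False using q1 \<epsilon> by linarith
qed

end

context tg_flow
begin

text \<open>Choose \<open>f\<^sub>0, f\<^sub>1, \<dots>\<close> in the family such that the open sets where \<open>f\<^sub>j < 1/3\<close> for all
  \<open>j < n\<close> meet \<open>M\<close>, and such that \<open>f\<^sub>n > 2/3\<close> at some point of \<open>M\<close> in the \<open>n\<close>-th of them: finitely
  many group elements \<open>E\<close> bring every point of \<open>M\<close> into the current open set, so it suffices to
  choose \<open>f\<^sub>n\<close> such that \<open>f\<^sub>n < 1/3\<close> on \<open>E x\<close> and \<open>f\<^sub>n > 2/3\<close> on \<open>E y\<close> for some \<open>x\<close> and \<open>y\<close> in \<open>M\<close>.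
  The bumps \<open>g\<^sub>n = max 0 (min (min\<^sub>j\<^sub><\<^sub>n (1/2 - f\<^sub>j)) (f\<^sub>n - 1/2))\<close> inherit the modulus, exceed
  \<open>1/6\<close> somewhere on \<open>M\<close>, and are nonzero at disjoint sets of points, because \<open>g\<^sub>n x > 0\<close> makes \<open>n\<close>
  the first index with \<open>f\<^sub>n x > 1/2\<close>.\<close>

lemma CAP_no_independent_family:
  assumes cap: "CAP TYPE('a \<Rightarrow> real) G T" and M: "minimal_subflow G X \<phi> M"
    and \<omega>: "tg.modulus \<omega>"
    and cont: "\<And>f. f \<in> \<F> \<Longrightarrow> continuous_map X euclideanreal f"
    and range: "\<And>f x. f \<in> \<F> \<Longrightarrow> x \<in> topspace X \<Longrightarrow> f x \<in> {0..1}"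
    and equi: "\<And>f u x. f \<in> \<F> \<Longrightarrow> u \<in> carrier G \<Longrightarrow> x \<in> topspace X \<Longrightarrow> \<bar>f (\<phi> u x) - f x\<bar> \<le> \<omega> u"
    and rich: "\<And>E. finite E \<Longrightarrow> E \<subseteq> carrier G \<Longrightarrow> \<exists>f\<in>\<F>.
      (\<exists>x\<in>M. \<forall>e\<in>E. f (\<phi> e x) < 1/3) \<and> (\<exists>x\<in>M. \<forall>e\<in>E. 2/3 < f (\<phi> e x))"
  shows False
proof -
  have MX: "M \<subseteq> topspace X" using M subflow_subset unfolding minimal_subflow_def by blast
  have Minv: "\<phi> g x \<in> M" if "g \<in> carrier G" "x \<in> M" for g x
    using that M unfolding minimal_subflow_def subflow_def by blast
  \<comment> \<open>An invariant of the minima \<open>min\<^sub>j\<^sub><\<^sub>n (1/2 - f\<^sub>j)\<close>, which record the choices made so far and start with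
    the constant \<open>1\<close>; the bound is \<open>1/6 = 1/2 - 1/3\<close>.\<close>
  define good where "good m \<longleftrightarrow> continuous_map X euclideanreal m \<and> (\<forall>x\<in>topspace X. m x \<le> 1) \<and>
    (\<forall>u\<in>carrier G. \<forall>x\<in>topspace X. \<bar>m (\<phi> u x) - m x\<bar> \<le> \<omega> u) \<and> (\<exists>x\<in>M. 1/6 < m x)" for m
  have step: "\<exists>f. f \<in> \<F> \<and> good (\<lambda>x. min (m x) (1/2 - f x)) \<and> (\<exists>x\<in>M. 1/6 < m x \<and> 2/3 < f x)"
    if m: "good m" for m
  proof -
    define P where "P = {x \<in> topspace X. m x \<in> {1/6<..}}"
    have P: "openin X P"
      unfolding P_def using m by (intro openin_continuous_map_preimage[of _ euclideanreal]) (auto simp: good_def)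
    obtain x0 where "x0 \<in> M" "x0 \<in> P" using m MX by (auto simp: good_def P_def)
    then obtain E where E: "finite E" "E \<subseteq> carrier G" "\<And>x. x \<in> M \<Longrightarrow> \<exists>e\<in>E. \<phi> e x \<in> P"
      using minimal_subflow_finite_return[OF M P] by metis
    obtain f x y where f: "f \<in> \<F>" and x: "x \<in> M" "\<forall>e\<in>E. f (\<phi> e x) < 1/3"
      and y: "y \<in> M" "\<forall>e\<in>E. 2/3 < f (\<phi> e y)"
      using rich[OF E(1,2)] by blast
    obtain e where e: "e \<in> E" "\<phi> e x \<in> P" using E(3)[OF x(1)] by blast
    obtain e' where e': "e' \<in> E" "\<phi> e' y \<in> P" using E(3)[OF y(1)] by blast
    have "good (\<lambda>x. min (m x) (1/2 - f x))"
      unfolding good_def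
    proof (intro conjI ballI)
      show "continuous_map X euclideanreal (\<lambda>x. min (m x) (1/2 - f x))"
        using m cont[OF f] by (intro continuous_map_real_min continuous_map_diff) (auto simp: good_def)
      show "min (m x) (1/2 - f x) \<le> 1" if "x \<in> topspace X" for x
        using m that by (auto simp: good_def min_le_iff_disj)
      show "\<bar>min (m (\<phi> u x)) (1/2 - f (\<phi> u x)) - min (m x) (1/2 - f x)\<bar> \<le> \<omega> u"
        if "u \<in> carrier G" "x \<in> topspace X" for u x
      proof -
        have "\<bar>m (\<phi> u x) - m x\<bar> \<le> \<omega> u" using m that unfolding good_def by blast
        then show ?thesis using equi[OF f that] by (auto simp: min_def abs_le_iff)
      qed
      show "\<exists>x\<in>M. 1/6 < min (m x) (1/2 - f x)"
      proof
        show "\<phi> e x \<in> M" using Minv e(1) E(2) x(1) by blast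
        have "f (\<phi> e x) < 1/3" using x(2) e(1) by blast
        then show "1/6 < min (m (\<phi> e x)) (1/2 - f (\<phi> e x))" using e(2) by (auto simp: P_def)
      qed
    qed
    moreover have "\<phi> e' y \<in> M" using Minv e'(1) E(2) y(1) by blast
    moreover have "1/6 < m (\<phi> e' y)" "2/3 < f (\<phi> e' y)" using e' y(2) by (auto simp: P_def)
    ultimately show ?thesis using f by blast
  qed
  then have "\<forall>m. \<exists>f. good m \<longrightarrow>
      f \<in> \<F> \<and> good (\<lambda>x. min (m x) (1/2 - f x)) \<and> (\<exists>x\<in>M. 1/6 < m x \<and> 2/3 < f x)" by blast
  from choice[OF this] obtain sel where sel: "\<And>m. good m \<Longrightarrow> sel m \<in> \<F>"
    "\<And>m. good m \<Longrightarrow> good (\<lambda>x. min (m x) (1/2 - sel m x))"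
    "\<And>m. good m \<Longrightarrow> \<exists>x\<in>M. 1/6 < m x \<and> 2/3 < sel m x"
    by blast
  define m where "m = rec_nat (\<lambda>x. 1) (\<lambda>n m x. min (m x) (1/2 - sel m x))"
  have mSuc: "m (Suc n) = (\<lambda>x. min (m n x) (1/2 - sel (m n) x))" for n
    by (simp add: m_def)
  have good: "good (m n)" for n
  proof (induction n)
    case 0
    have "M \<noteq> {}" using M by (simp add: minimal_subflow_def subflow_def)
    then show ?case using \<omega> by (auto simp: m_def good_def tg.modulus_def)
  next
    case (Suc n)
    then show ?case unfolding mSuc by (rule sel(2))
  qed
  have mono: "m n' x \<le> m n x" if "n \<le> n'" for n n' x
    using that by (induction rule: dec_induct) (auto simp: mSuc)
  define g where "g n x = max 0 (min (m n x) (sel (m n) x - 1/2))" for n x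
  have "\<exists>n. \<forall>x\<in>M. g n x < 1/6"
  proof (rule CAP_pointwise_decay_imp_uniform[OF cap M _ _ \<omega>])
    fix n
    show "continuous_map X euclideanreal (g n)"
      unfolding g_def using good[of n] cont[OF sel(1)[OF good[of n]]]
      by (intro continuous_map_real_max continuous_map_real_min continuous_map_diff) (auto simp: good_def)
    show "g n x \<in> {0..1}" if "x \<in> topspace X" for x
      using good[of n] that by (auto simp: g_def good_def min_le_iff_disj)
    show "\<bar>g n (\<phi> u x) - g n x\<bar> \<le> \<omega> u" if "u \<in> carrier G" "x \<in> topspace X" for u x
    proof -
      have "\<bar>m n (\<phi> u x) - m n x\<bar> \<le> \<omega> u" using good[of n] that unfolding good_def by blast
      then show ?thesis using equi[OF sel(1)[OF good[of n]] that] unfolding g_def by linarith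
    qed
  next
    fix x assume "x \<in> M"
    have "\<exists>N. \<forall>n\<ge>N. g n x = 0"
    proof (cases "\<exists>j. 1/2 \<le> sel (m j) x")
      case True
      then obtain j where "1/2 \<le> sel (m j) x" by blast
      then have "m (Suc j) x \<le> 0" by (simp add: mSuc)
      then have "m n x \<le> 0" if "Suc j \<le> n" for n using mono[OF that, of x] by linarith
      then have "\<forall>n\<ge>Suc j. g n x = 0" by (simp add: g_def max_absorb1 min.coboundedI1)
      then show ?thesis by blast
    next
      case False
      then have "sel (m n) x - 1/2 \<le> 0" for n by (simp add: not_le less_imp_le)
      then have "\<forall>n. g n x = 0" by (simp add: g_def max_absorb1 min.coboundedI2)
      then show ?thesis by blast
    qed
    then show "(\<lambda>n. g n x) \<longlonglongrightarrow> 0"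
      using tendsto_eventually[of "\<lambda>n. g n x" 0] by (auto simp: eventually_sequentially)
  qed auto
  then obtain n where n: "\<And>x. x \<in> M \<Longrightarrow> g n x < 1/6" by blast
  obtain x where "x \<in> M" "1/6 < m n x" "2/3 < sel (m n) x" using sel(3)[OF good] by blast
  then show False using n[of x] unfolding g_def by linarith
qed

section \<open>The relation of lying in the same minimal subflow\<close>

definition power_action :: "'i set \<Rightarrow> 'a \<Rightarrow> ('i \<Rightarrow> 'x) \<Rightarrow> 'i \<Rightarrow> 'x" where
  "power_action I g = (\<lambda>p\<in>I \<rightarrow>\<^sub>E topspace X. \<lambda>i\<in>I. \<phi> g (p i))"

lemma power_flow: "tg_flow G T (product_topology (\<lambda>_. X) I) (power_action I)"
proof -
  let ?P = "product_topology (\<lambda>_. X) I"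
  have closed: "power_action I g p \<in> I \<rightarrow>\<^sub>E topspace X"
    if "g \<in> carrier G" "p \<in> I \<rightarrow>\<^sub>E topspace X" for g p
    using that act_closed by (auto simp: power_action_def PiE_iff)
  have "group_action G (I \<rightarrow>\<^sub>E topspace X) (power_action I)"
  proof (rule group_actionI)
    show "power_action I \<one> p = p" if "p \<in> I \<rightarrow>\<^sub>E topspace X" for p
      using that by (auto simp: power_action_def PiE_iff extensional_def act_one)
    show "power_action I (g \<otimes> h) p = power_action I g (power_action I h p)"
      if "g \<in> carrier G" "h \<in> carrier G" "p \<in> I \<rightarrow>\<^sub>E topspace X" for g h p
      using that closed[of h p] by (auto simp: power_action_def act_mult PiE_iff)
    show "power_action I g \<in> extensional (I \<rightarrow>\<^sub>E topspace X)" for g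
      by (simp add: power_action_def)
  qed (rule group_G, rule closed)
  moreover have "continuous_map (prod_topology T ?P) ?P (\<lambda>(g, p). power_action I g p)"
    unfolding continuous_map_componentwise
  proof (intro conjI ballI)
    show "(\<lambda>(g, p). power_action I g p) ` topspace (prod_topology T ?P) \<subseteq> extensional I"
      using closed tg.topspace_eq by (auto simp: PiE_iff)
    fix i assume i: "i \<in> I"
    have "continuous_map (prod_topology T ?P) (prod_topology T X) (\<lambda>(g, p). (g, p i))"
      using continuous_map_compose[OF continuous_map_snd continuous_map_product_projection[OF i]]
      by (auto simp: continuous_map_pairwise o_def case_prod_unfold continuous_map_fst)
    from continuous_map_compose[OF this continuous_action]
    show "continuous_map (prod_topology T ?P) X (\<lambda>x. (case x of (g, p) \<Rightarrow> power_action I g p) i)"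
      by (rule continuous_map_eq) (auto simp: power_action_def i)
  qed
  moreover have "compact_space ?P"
    using compact by (simp add: compact_space_product_topology)
  moreover have "Hausdorff_space ?P"
    using Hausdorff by (simp add: Hausdorff_space_product_topology)
  moreover have "I \<rightarrow>\<^sub>E topspace X \<noteq> {}" using nonempty by (simp add: PiE_eq_empty_iff)
  ultimately show ?thesis
    using tg.topological_group_axioms
    unfolding tg_flow_def flow_def flow_axioms_def by simp
qed

lemma CAP_closedin_AP: "CAP TYPE('a \<Rightarrow> real) G T \<Longrightarrow> closedin X (AP G X \<phi>)"
  using CAP_every_type[OF tg.topological_group_axioms] flow_axioms unfolding CAP_def by blast

text \<open>For a CAP group both \<open>z\<close> and \<open>w\<close> are almost periodic, as limits of points \<open>y\<close> and \<open>h y\<close>.  If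
  their minimal orbit closures are different, they are disjoint, and some \<open>f\<close> separates them.
  The orbit closures of the various \<open>y\<close> are all factors of a single minimal flow, found in the
  power of \<open>X\<close> with one coordinate for each almost periodic point \<open>y\<close>, inside the orbit closure of
  the point whose coordinate at \<open>y\<close> is \<open>y\<close>.  Reading \<open>f\<close> in the various coordinates gives a family of
  functions that contradicts \<open>CAP_no_independent_family\<close>.\<close>

lemma CAP_same_minimal_subflow_closed:
  assumes cap: "CAP TYPE('a \<Rightarrow> real) G T"
    and z: "z \<in> topspace X" and w: "w \<in> topspace X"
    and near: "\<And>V W. openin X V \<Longrightarrow> openin X W \<Longrightarrow> z \<in> V \<Longrightarrow> w \<in> W \<Longrightarrow>
      \<exists>y\<in>AP G X \<phi> \<inter> V. \<exists>h\<in>carrier G. \<phi> h y \<in> W"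
  shows "w \<in> orbit_closure G X \<phi> z"
proof (rule ccontr)
  assume nw: "w \<notin> orbit_closure G X \<phi> z"
  let ?AP = "AP G X \<phi>" and ?Z = "orbit_closure G X \<phi> z" and ?W = "orbit_closure G X \<phi> w"
  have clAP: "X closure_of ?AP = ?AP" using CAP_closedin_AP[OF cap] by (simp add: closure_of_eq)
  have "z \<in> X closure_of ?AP"
    using near[OF _ openin_topspace _ w] z unfolding in_closure_of by blast
  then have zAP: "z \<in> ?AP" using clAP by simp
  have "w \<in> X closure_of ?AP"
    using near[OF openin_topspace _ z] w AP_act unfolding in_closure_of by blast
  then have wAP: "w \<in> ?AP" using clAP by simp
  have "?Z \<inter> ?W = {}"
    using AP_orbit_closure(2)[OF zAP] AP_orbit_closure(2)[OF wAP] nw self_in_orbit_closure[OF w] by blast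
  then have dis: "disjnt ?Z ?W" by (simp add: disjnt_def)
  have nrm: "normal_space X"
    using compact Hausdorff by (simp add: compact_Hausdorff_or_regular_imp_normal_space)
  obtain f where f0: "continuous_map X (top_of_set {0..1::real}) f" "f ` ?Z \<subseteq> {0}" "f ` ?W \<subseteq> {1}"
    using Urysohn_lemma[OF nrm closedin_closure_of closedin_closure_of dis, of 0 1] by (metis zero_le_one)
  have f: "continuous_map X euclideanreal f" and f01: "\<And>x. x \<in> topspace X \<Longrightarrow> f x \<in> {0..1}"
    using f0(1) by (auto simp: continuous_map_in_subtopology)
  \<comment> \<open>One modulus serves all coordinates of the power, since \<open>f\<close> is the same in each of them.\<close>
  define \<omega> where "\<omega> u = (if u \<in> carrier G then (SUP x\<in>topspace X. \<bar>f (\<phi> u x) - f x\<bar>) else 0)" for u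
  have bdd: "bdd_above ((\<lambda>x. \<bar>f (\<phi> u x) - f x\<bar>) ` topspace X)" if "u \<in> carrier G" for u
  proof (rule bdd_aboveI2)
    fix x assume x: "x \<in> topspace X"
    then show "\<bar>f (\<phi> u x) - f x\<bar> \<le> 1" using f01[OF x] f01[OF act_closed[OF that x]] by auto
  qed
  have \<omega>f: "\<bar>f (\<phi> u x) - f x\<bar> \<le> \<omega> u" if "u \<in> carrier G" "x \<in> topspace X" for u x
    unfolding \<omega>_def using that cSUP_upper[OF that(2) bdd[OF that(1)]] by simp
  have \<omega>: "tg.modulus \<omega>"
    unfolding tg.modulus_def
  proof (intro conjI allI impI)
    show "0 \<le> \<omega> u" for u
    proof (cases "u \<in> carrier G")
      case True
      then show ?thesis using \<omega>f[OF True z] by linarith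
    qed (simp add: \<omega>_def)
    fix \<epsilon> :: real assume \<epsilon>: "0 < \<epsilon>"
    then obtain U where U: "openin T U" "\<one> \<in> U"
      "\<And>u x. u \<in> U \<Longrightarrow> x \<in> topspace X \<Longrightarrow> \<bar>f (\<phi> u x) - f x\<bar> < \<epsilon> / 2"
      using uniform_modulus[OF f, of "\<epsilon> / 2"] by (metis half_gt_zero)
    have "\<omega> u < \<epsilon>" if u: "u \<in> U" for u
    proof -
      have "(SUP x\<in>topspace X. \<bar>f (\<phi> u x) - f x\<bar>) \<le> \<epsilon> / 2"
        using nonempty U(3)[OF u] by (intro cSUP_least) (auto intro: less_imp_le)
      then show ?thesis using \<epsilon> by (auto simp: \<omega>_def)
    qed
    then show "\<exists>U. openin T U \<and> \<one> \<in> U \<and> (\<forall>u\<in>U. \<omega> u < \<epsilon>)" using U by blast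
  qed
  let ?P = "product_topology (\<lambda>_. X) ?AP" and ?\<psi> = "power_action ?AP"
  interpret P: tg_flow G T ?P ?\<psi> by (rule power_flow)
  define d where "d = (\<lambda>y\<in>?AP. y)"
  have d: "d \<in> topspace ?P" using AP_subset by (auto simp: d_def)
  obtain M where M: "minimal_subflow G ?P ?\<psi> M" "M \<subseteq> orbit_closure G ?P ?\<psi> d"
    using P.minimal_subflow_exists[OF P.subflow_orbit_closure[OF d]] by metis
  have MP: "M \<subseteq> topspace ?P" using M(2) P.orbit_closure_subset by blast
  have proj_cont: "continuous_map ?P X (\<lambda>p. p y)" if "y \<in> ?AP" for y
    using that by (rule continuous_map_product_projection)
  have proj_equi: "?\<psi> g p y = \<phi> g (p y)" if "y \<in> ?AP" "g \<in> carrier G" "p \<in> topspace ?P" for g p y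
    using that by (simp add: power_action_def)
  \<comment> \<open>The image of \<open>M\<close> in the coordinate \<open>y\<close> is an orbit closure inside the minimal one of \<open>y\<close>.\<close>
  have proj_onto: "\<exists>p\<in>M. p y = x" if y: "y \<in> ?AP" and x: "x \<in> orbit_closure G X \<phi> y" for x y
  proof -
    have img: "orbit_closure G X \<phi> (p y) = (\<lambda>p. p y) ` orbit_closure G ?P ?\<psi> p"
      if "p \<in> topspace ?P" for p
      using P.orbit_closure_image[OF tg_flow_axioms proj_cont[OF y] _ that] proj_equi[OF y] by blast
    obtain p where p: "p \<in> M" using M(1) by (auto simp: minimal_subflow_def subflow_def)
    have "d y = y" using y by (simp add: d_def)
    then have "p y \<in> orbit_closure G X \<phi> y" using img[OF d] p M(2) by auto
    then have "orbit_closure G X \<phi> y = orbit_closure G X \<phi> (p y)" using AP_orbit_closure(2)[OF y] by simp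
    also have "\<dots> = (\<lambda>p. p y) ` M"
      using img[of p] p MP P.minimal_subflow_eq_orbit_closure[OF M(1) p] by auto
    finally show ?thesis using x by auto
  qed
  show False
  proof (rule P.CAP_no_independent_family[OF cap M(1) \<omega>, of "(\<lambda>y p. f (p y)) ` ?AP"])
    fix F assume "F \<in> (\<lambda>y p. f (p y)) ` ?AP"
    then obtain y where y: "y \<in> ?AP" "F = (\<lambda>p. f (p y))" by blast
    show "continuous_map ?P euclideanreal F"
      using continuous_map_compose[OF proj_cont[OF y(1)] f] y(2) by (simp add: o_def)
    show "F p \<in> {0..1}" if "p \<in> topspace ?P" for p
      using that f01[of "p y"] y by (auto simp: PiE_iff)
    show "\<bar>F (?\<psi> u p) - F p\<bar> \<le> \<omega> u" if "u \<in> carrier G" "p \<in> topspace ?P" for u p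
      using that \<omega>f[of u "p y"] proj_equi[OF y(1) that] y by (auto simp: PiE_iff)
  next
    fix E assume E: "finite E" "E \<subseteq> carrier G"
    define V where "V = {x \<in> topspace X. \<forall>e\<in>E. \<phi> e x \<in> {x \<in> topspace X. f x \<in> {..<1/3}}}"
    define W where "W = {x \<in> topspace X. \<forall>e\<in>E. \<phi> e x \<in> {x \<in> topspace X. f x \<in> {2/3<..}}}"
    have "openin X V" "openin X W"
      unfolding V_def W_def
      by (intro openin_finite_act_preimage[OF E] openin_continuous_map_preimage[OF f]; simp)+
    moreover have "f (\<phi> e z) = 0" "f (\<phi> e w) = 1" if "e \<in> E" for e
      using f0(2,3) act_in_orbit_closure[OF z, of e] act_in_orbit_closure[OF w, of e] that E(2) by blast+
    then have "z \<in> V" "w \<in> W"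
      using z w E(2) act_closed by (auto simp: V_def W_def)
    ultimately obtain y h where y: "y \<in> ?AP" "y \<in> V" and h: "h \<in> carrier G" "\<phi> h y \<in> W"
      using near by blast
    have yX: "y \<in> topspace X" using y AP_subset by blast
    obtain p where p: "p \<in> M" "p y = y" using proj_onto[OF y(1) self_in_orbit_closure[OF yX]] by blast
    obtain q where q: "q \<in> M" "q y = \<phi> h y" using proj_onto[OF y(1) act_in_orbit_closure[OF yX h(1)]] by blast
    have "f (?\<psi> e p y) < 1/3" "2/3 < f (?\<psi> e q y)" if "e \<in> E" for e
      using that y(2) h(2) p q proj_equi[OF y(1), of e] MP E(2) by (auto simp: V_def W_def subset_iff)
    then have "(\<exists>p\<in>M. \<forall>e\<in>E. f (?\<psi> e p y) < 1/3) \<and> (\<exists>p\<in>M. \<forall>e\<in>E. 2/3 < f (?\<psi> e p y))"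
      using p(1) q(1) by blast
    then show "\<exists>F\<in>(\<lambda>y p. f (p y)) ` ?AP.
        (\<exists>p\<in>M. \<forall>e\<in>E. F (?\<psi> e p) < 1/3) \<and> (\<exists>p\<in>M. \<forall>e\<in>E. 2/3 < F (?\<psi> e p))"
      using y(1) by (rule_tac x = "\<lambda>p. f (p y)" in bexI) blast+
  qed
qed

end

section \<open>Almost periodic points for a subgroup\<close>

lemma (in topological_group) subgroup_topological_group:
  assumes H: "subgroup H G"
  shows "topological_group (G\<lparr>carrier := H\<rparr>) (subtopology T H)"
proof -
  let ?T = "subtopology T H"
  interpret H: group "G\<lparr>carrier := H\<rparr>" using H is_group by (rule subgroup.subgroup_is_group)
  have tH: "topspace ?T = H" using subgroup.subset[OF H] topspace_eq by auto
  have "continuous_map (prod_topology ?T ?T) ?T (\<lambda>(g, h). g \<otimes> h)"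
    unfolding continuous_map_in_subtopology
    using continuous_map_from_subtopology[OF continuous_mult, of "H \<times> H"] tH subgroup.m_closed[OF H]
    by (auto simp: subtopology_Times)
  moreover have "continuous_map ?T ?T (\<lambda>g. inv\<^bsub>G\<lparr>carrier := H\<rparr>\<^esub> g)"
  proof (rule continuous_map_eq)
    show "continuous_map ?T ?T (\<lambda>g. inv g)"
      unfolding continuous_map_in_subtopology
      using tH subgroup.m_inv_closed[OF H]
      by (auto intro: continuous_map_from_subtopology continuous_inv)
    show "inv x = inv\<^bsub>G\<lparr>carrier := H\<rparr>\<^esub> x" if "x \<in> topspace ?T" for x
      using that tH m_inv_consistent[OF H] by simp
  qed
  ultimately show ?thesis
    using tH Hausdorff
    by unfold_locales (auto simp: Hausdorff_space_subtopology)
qed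

context tg_flow
begin

lemma subgroup_flow:
  assumes H: "subgroup H G"
  shows "tg_flow (G\<lparr>carrier := H\<rparr>) (subtopology T H) X \<phi>"
proof -
  have HG: "h \<in> carrier G" if "h \<in> H" for h using that H by (rule subgroup.mem_carrier[rotated])
  have "group_action (G\<lparr>carrier := H\<rparr>) (topspace X) \<phi>"
  proof (rule group_actionI)
    show "group (G\<lparr>carrier := H\<rparr>)" using H group_G by (rule subgroup.subgroup_is_group)
    show "\<phi> g \<in> extensional (topspace X)" if "g \<in> carrier (G\<lparr>carrier := H\<rparr>)" for g
      using bij_prop0[of g] HG that by (simp add: Bij_def)
  qed (use HG act_closed act_one act_mult in auto)
  moreover have "continuous_map (prod_topology (subtopology T H) X) X (\<lambda>(g, x). \<phi> g x)"
    using continuous_map_from_subtopology[OF continuous_action, of "H \<times> topspace X"]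
    by (simp add: subtopology_Times)
  ultimately show ?thesis
    using tg.subgroup_topological_group[OF H] nonempty compact Hausdorff
    unfolding tg_flow_def flow_def flow_axioms_def by blast
qed

text \<open>It suffices that the \<open>G\<close>-orbit closure of every \<open>y\<close> in that of \<open>x\<close> meets the \<open>H\<close>-orbit closure
  of \<open>x\<close>, because the latter is \<open>H\<close>-minimal and so leads back to \<open>x\<close>.  If it does not, some
  neighbourhood \<open>U\<close> of the identity cannot move points near the \<open>H\<close>-orbit closure of \<open>x\<close> to points
  near the \<open>G\<close>-orbit closure of \<open>y\<close>.  But \<open>y\<close> is a limit of points \<open>f u h x\<close> with \<open>u \<in> U\<close>,
  \<open>h \<in> H\<close> and \<open>f\<close> in a finite set, so the inverse of some \<open>f\<close> moves \<open>y\<close> close to \<open>u h x\<close>.\<close>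

lemma pre_syndetic_AP_subset:
  assumes H: "subgroup H G" and syn: "pre_syndetic G T H"
  shows "AP (G\<lparr>carrier := H\<rparr>) X \<phi> \<subseteq> AP G X \<phi>"
proof
  let ?H = "G\<lparr>carrier := H\<rparr>"
  interpret H: tg_flow ?H "subtopology T H" X \<phi> using H by (rule subgroup_flow)
  have HG: "H \<subseteq> carrier G" using H by (rule subgroup.subset)
  have sub: "orbit_closure ?H X \<phi> x \<subseteq> orbit_closure G X \<phi> x" for x
    using HG by (intro closure_of_mono) (auto simp: orbit_def)
  fix x assume x: "x \<in> AP ?H X \<phi>"
  have xX: "x \<in> topspace X" using x H.AP_subset by blast
  show "x \<in> AP G X \<phi>"
  proof (rule AP_I[OF xX])
    fix y assume y: "y \<in> orbit_closure G X \<phi> x"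
    have yX: "y \<in> topspace X" using y orbit_closure_subset by blast
    have "orbit_closure ?H X \<phi> x \<inter> orbit_closure G X \<phi> y \<noteq> {}"
    proof
      assume dis: "orbit_closure ?H X \<phi> x \<inter> orbit_closure G X \<phi> y = {}"
      obtain U P N where U: "openin T U" "\<one> \<in> U" and P: "orbit_closure ?H X \<phi> x \<subseteq> P"
        and N: "openin X N" "orbit_closure G X \<phi> y \<subseteq> N"
        and UP: "\<And>u p. u \<in> U \<Longrightarrow> p \<in> P \<Longrightarrow> \<phi> u p \<notin> N"
        using neighbourhood_separation[OF closedin_closure_of closedin_closure_of dis] by metis
      have UG: "U \<subseteq> carrier G" using openin_subset[OF U(1)] tg.topspace_eq by simp
      obtain F where F: "finite F" "F \<subseteq> carrier G" "F <#> U <#> H = carrier G"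
        using syn U unfolding pre_syndetic_def by blast
      \<comment> \<open>The finitely many \<open>f\<close> are undone on a neighbourhood of \<open>y\<close>.\<close>
      define N' where "N' = {v \<in> topspace X. \<forall>k\<in>(\<lambda>f. inv f) ` F. \<phi> k v \<in> N}"
      have "openin X N'"
        unfolding N'_def using F(1,2) N(1) by (intro openin_finite_act_preimage) auto
      moreover have "\<phi> (inv f) y \<in> N" if "f \<in> F" for f
        using act_in_orbit_closure[OF yX, of "inv f"] N(2) F(2) that by auto
      then have "y \<in> N'" using yX by (auto simp: N'_def)
      ultimately obtain g where g: "g \<in> carrier G" "\<phi> g x \<in> N'"
        using orbit_meets_neighbourhood[OF y] by metis
      then obtain f u h where fuh: "f \<in> F" "u \<in> U" "h \<in> H" "g = f \<otimes> u \<otimes> h"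
        using F(3) unfolding set_mult_def by blast
      have G: "f \<in> carrier G" "u \<in> carrier G" "h \<in> carrier G" using fuh F(2) UG HG by auto
      have "\<phi> g x = \<phi> f (\<phi> u (\<phi> h x))" using G xX by (simp add: fuh(4) act_mult act_closed)
      then have "\<phi> (inv f) (\<phi> g x) = \<phi> u (\<phi> h x)" using G xX act_inv(1) act_closed by simp
      then have "\<phi> u (\<phi> h x) \<in> N" using g(2) fuh(1) unfolding N'_def by force
      moreover have "\<phi> h x \<in> P" using H.act_in_orbit_closure[OF xX] fuh(3) P by auto
      ultimately show False using UP fuh(2) by blast
    qed
    then obtain v where v: "v \<in> orbit_closure ?H X \<phi> x" "v \<in> orbit_closure G X \<phi> y" by blast
    have "x \<in> orbit_closure ?H X \<phi> v"
      using H.AP_orbit_closure(2)[OF x v(1)] H.self_in_orbit_closure[OF xX] by simp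
    then show "x \<in> orbit_closure G X \<phi> y"
      using sub orbit_closure_mono[OF yX v(2)] by blast
  qed
qed

text \<open>The points \<open>z\<close> and \<open>w\<close> below are those of the outline at the beginning.  They are cluster points
  of the sets \<open>S V\<close> of candidates for \<open>y\<close>, for neighbourhoods \<open>V\<close> of \<open>x\<close>, and of the sets \<open>R W\<close> of
  candidates for \<open>h y\<close>, for neighbourhoods \<open>W\<close> of \<open>z\<close>.\<close>

lemma closedin_AP_of_subgroup:
  assumes H: "subgroup H G" and pre: "co_precompact G T H" and syn: "pre_syndetic G T H"
    and cap: "CAP TYPE('a \<Rightarrow> real) (G\<lparr>carrier := H\<rparr>) (subtopology T H)"
  shows "closedin X (AP G X \<phi>)"
proof -
  let ?H = "G\<lparr>carrier := H\<rparr>"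
  interpret H: tg_flow ?H "subtopology T H" X \<phi> using H by (rule subgroup_flow)
  have HG: "H \<subseteq> carrier G" using H by (rule subgroup.subset)
  have "x \<in> AP G X \<phi>" if x: "x \<in> X closure_of (AP G X \<phi>)" for x
  proof -
    have xX: "x \<in> topspace X" using x by (meson in_closure_of)
    define S where "S V = {y \<in> AP ?H X \<phi>. \<exists>g\<in>carrier G. \<phi> g y \<in> V}" for V
    obtain z where z: "z \<in> topspace X" "\<And>V. openin X V \<Longrightarrow> x \<in> V \<Longrightarrow> z \<in> X closure_of S V"
    proof (rule directed_cluster_point[OF compact, of "S ` {V. openin X V \<and> x \<in> V}"])
      show "S ` {V. openin X V \<and> x \<in> V} \<noteq> {}" using xX by blast
      show "B \<noteq> {} \<and> B \<subseteq> topspace X" if B: "B \<in> S ` {V. openin X V \<and> x \<in> V}" for B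
      proof -
        from B obtain V where V: "openin X V" "x \<in> V" "B = S V" by blast
        obtain x' where x': "x' \<in> AP G X \<phi>" "x' \<in> V" using x V(1,2) unfolding in_closure_of by blast
        have x'X: "x' \<in> topspace X" using x'(1) AP_subset by blast
        have "subflow ?H X \<phi> (orbit_closure G X \<phi> x')"
          using subflow_orbit_closure[OF x'X] HG unfolding subflow_def by auto
        then obtain M where M: "minimal_subflow ?H X \<phi> M" "M \<subseteq> orbit_closure G X \<phi> x'"
          using H.minimal_subflow_exists by metis
        obtain y where y: "y \<in> M" using M(1) by (auto simp: minimal_subflow_def subflow_def)
        have "x' \<in> orbit_closure G X \<phi> y"
          using AP_orbit_closure(2)[OF x'(1)] M(2) y self_in_orbit_closure[OF x'X] by blast
        then obtain g where "g \<in> carrier G" "\<phi> g y \<in> V"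
          using orbit_meets_neighbourhood[OF _ V(1) x'(2)] by metis
        then have "y \<in> B" using H.minimal_subflow_subset_AP[OF M(1)] y V(3) by (auto simp: S_def)
        then show ?thesis using H.AP_subset V(3) by (auto simp: S_def)
      qed
      fix A B assume "A \<in> S ` {V. openin X V \<and> x \<in> V}" "B \<in> S ` {V. openin X V \<and> x \<in> V}"
      then obtain V W where VW: "A = S V" "B = S W" "openin X V" "openin X W" "x \<in> V" "x \<in> W" by blast
      have "S (V \<inter> W) \<in> S ` {V. openin X V \<and> x \<in> V}" using VW by (intro imageI) auto
      moreover have "S (V \<inter> W) \<subseteq> A \<inter> B" using VW(1,2) by (auto simp: S_def)
      ultimately show "\<exists>C\<in>S ` {V. openin X V \<and> x \<in> V}. C \<subseteq> A \<inter> B" by blast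
    qed auto
    have "z \<in> X closure_of AP ?H X \<phi>"
      using z(2)[OF openin_topspace xX] closure_of_mono[of "S (topspace X)" "AP ?H X \<phi>" X]
      by (auto simp: S_def)
    then have "z \<in> AP ?H X \<phi>"
      using H.CAP_closedin_AP[OF cap] by (simp add: closure_of_closedin)
    then have zAP: "z \<in> AP G X \<phi>" using pre_syndetic_AP_subset[OF H syn] by blast
    let ?Z = "orbit_closure G X \<phi> z"
    have "x \<in> ?Z"
    proof (rule ccontr)
      assume "x \<notin> ?Z"
      then have dis: "?Z \<inter> {x} = {}" by blast
      have "closedin X {x}" using Hausdorff xX by (simp add: closedin_Hausdorff_singleton)
      from neighbourhood_separation[OF closedin_closure_of this dis]
      obtain U P N where U: "openin T U" "\<one> \<in> U" and P: "openin X P" "?Z \<subseteq> P"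
        and N: "openin X N" "{x} \<subseteq> N"
        and UP: "\<And>u p. u \<in> U \<Longrightarrow> p \<in> P \<Longrightarrow> \<phi> u p \<notin> N"
        by metis
      have UG: "U \<subseteq> carrier G" using openin_subset[OF U(1)] tg.topspace_eq by simp
      obtain F where F: "finite F" "F \<subseteq> carrier G" "U <#> F <#> H = carrier G"
        using tg.co_precompact_imp_finite_cover[OF H pre U] by blast
      define R where "R W = {\<phi> h y | h y. h \<in> H \<and> y \<in> AP ?H X \<phi> \<inter> W \<and>
          (\<exists>u\<in>U. \<exists>f\<in>F. \<phi> u (\<phi> f (\<phi> h y)) \<in> N)}" for W
      obtain w where w: "w \<in> topspace X" "\<And>W. openin X W \<Longrightarrow> z \<in> W \<Longrightarrow> w \<in> X closure_of R W"
      proof (rule directed_cluster_point[OF compact, of "R ` {W. openin X W \<and> z \<in> W}"])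
        show "R ` {W. openin X W \<and> z \<in> W} \<noteq> {}" using z(1) by blast
        show "B \<noteq> {} \<and> B \<subseteq> topspace X" if B: "B \<in> R ` {W. openin X W \<and> z \<in> W}" for B
        proof -
          from B obtain W where W: "openin X W" "z \<in> W" "B = R W" by blast
          have "z \<in> X closure_of S N" using z(2) N by blast
          then obtain y where y: "y \<in> S N" "y \<in> W" using W unfolding in_closure_of by blast
          then obtain g where g: "y \<in> AP ?H X \<phi>" "g \<in> carrier G" "\<phi> g y \<in> N" unfolding S_def by blast
          then obtain u f h where ufh: "u \<in> U" "f \<in> F" "h \<in> H" "g = u \<otimes> f \<otimes> h"
            using F(3) unfolding set_mult_def by blast
          have G: "f \<in> carrier G" "u \<in> carrier G" "h \<in> carrier G" using ufh F(2) UG HG by auto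
          have yX: "y \<in> topspace X" using g(1) H.AP_subset by blast
          have "\<phi> g y = \<phi> u (\<phi> f (\<phi> h y))" using G yX by (simp add: ufh(4) act_mult act_closed)
          then have "\<phi> h y \<in> R W" using g ufh y(2) unfolding R_def by force
          moreover have "R W \<subseteq> topspace X" using H.AP_subset HG act_closed by (auto simp: R_def)
          ultimately show ?thesis using W(3) by blast
        qed
        fix A B assume "A \<in> R ` {V. openin X V \<and> z \<in> V}" "B \<in> R ` {V. openin X V \<and> z \<in> V}"
        then obtain V W where VW: "A = R V" "B = R W" "openin X V" "openin X W" "z \<in> V" "z \<in> W" by blast
        have "R (V \<inter> W) \<in> R ` {V. openin X V \<and> z \<in> V}" using VW by (intro imageI) auto
        moreover have "R (V \<inter> W) \<subseteq> A \<inter> B" unfolding VW(1,2) R_def by blast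
        ultimately show "\<exists>C\<in>R ` {V. openin X V \<and> z \<in> V}. C \<subseteq> A \<inter> B" by blast
      qed auto
      have "w \<in> orbit_closure ?H X \<phi> z"
      proof (rule H.CAP_same_minimal_subflow_closed[OF cap z(1) w(1)])
        fix V W assume VW: "openin X V" "openin X W" "z \<in> V" "w \<in> W"
        have "w \<in> X closure_of R V" using w(2) VW by blast
        then obtain r where "r \<in> R V" "r \<in> W" using VW unfolding in_closure_of by blast
        then show "\<exists>y\<in>AP ?H X \<phi> \<inter> V. \<exists>h\<in>carrier ?H. \<phi> h y \<in> W" unfolding R_def by auto
      qed
      then have wZ: "w \<in> ?Z"
        using HG closure_of_mono[of "orbit ?H \<phi> z" "orbit G \<phi> z" X] by (auto simp: orbit_def)
      define Q where "Q = {v \<in> topspace X. \<forall>f\<in>F. \<phi> f v \<in> P}"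
      have "openin X Q" unfolding Q_def using F(1,2) P(1) by (rule openin_finite_act_preimage)
      moreover have "w \<in> Q"
        using w(1) wZ subflow_orbit_closure[OF z(1)] P(2) F(2) by (auto simp: Q_def subflow_def)
      moreover have "w \<in> X closure_of R (topspace X)" using w(2) z(1) by blast
      ultimately obtain r where "r \<in> R (topspace X)" "r \<in> Q" unfolding in_closure_of by blast
      then obtain u f where "u \<in> U" "f \<in> F" "\<phi> u (\<phi> f r) \<in> N" "\<phi> f r \<in> P"
        unfolding R_def Q_def by blast
      then show False using UP by blast
    qed
    then show ?thesis using AP_orbit_closure(1)[OF zAP] by blast
  qed
  then show ?thesis
    using AP_subset closure_of_subset_eq[of "AP G X \<phi>" X] by blast
qed

end

theorem proposition8p6:
  fixes G :: "('a, 'b) monoid_scheme" and T :: "'a topology" and H :: "'a set"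
  assumes "topological_group G T"
    and "subgroup H G"
    and "closedin T H"
    and "co_precompact G T H"
    and "pre_syndetic G T H"
    and "CAP TYPE('a \<Rightarrow> real) (G\<lparr>carrier := H\<rparr>) (subtopology T H)"
  shows "CAP TYPE('x) G T"
  unfolding CAP_def
proof (intro allI impI)
  fix X :: "'x topology" and \<phi>
  assume "flow G T X \<phi>"
  then interpret tg_flow G T X \<phi> using assms(1) by (simp add: tg_flow_def)
  show "closedin X (AP G X \<phi>)"
    using assms(2,4-6) by (rule closedin_AP_of_subgroup)
qed

end
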